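(* Let $F_1,F_2:\mathbb R^n\rightrightarrows\mathbb R^m$ be set-valued mappings, let $(\bar x,\bar y)\in\operatorname{gph}(F_1+F_2)$, let $\mathcal C_1,\mathcal C_2\subset\mathbb R^n$ be nonempty, closed and convex sets with $\bar x\in\mathcal C:=\mathcal C_1\cap\mathcal C_2$. Define $$S(x,y):=\{(y_1,y_2)\mid y_1\in F_1(x),\ y_2\in F_2(x),\ y_1+y_2=y\},\qquad (x,y)\in\mathbb R^n\times\mathbb R^m,$$ $$\Omega_i:=\{(x,y_1,y_2)\in\mathbb R^n\times\mathbb R^m\times\mathbb R^m\mid(x,y_i)\in\operatorname{gph}F_i\},\qquad i=1,2.$$ For $(\bar y_1,\bar y_2)\in S(\bar x,\bar y)$ consider the qualification conditions ($q_1$) $D^*_{\mathcal C_1}F_1(\bar x,\bar y_1)(0)\cap[-D^*_{\mathcal C_2}F_2(\bar x,\bar y_2)(0)]=\{0\}$; ($q_2$) $\{\Omega_1,\Omega_2\}$ are normal-densed in $\{\mathcal C_1\times\mathbb R^{2m},\mathcal C_2\times\mathbb R^{2m}\}$ at $(\bar x,\bar y_1,\bar y_2)$. Then the following assertions hold: (i) Let $(\bar y_1,\bar y_2)\in S(\bar x,\bar y)$ be such that ($q_1$) and ($q_2$) hold. If $\operatorname{gph}F_1$ and $\operatorname{gph}F_2$ are locally closed around $(\bar x,\bar y_1)$ and $(\bar x,\bar y_2)$ respectively, and $S$ is inner semicontinuous at $(\bar x,\bar y,\bar y_1,\bar y_2)$ with respect to $\mathcal C\times\mathbb R^m$, then $$D^*_{\mathcal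 C}(F_1+F_2)(\bar x,\bar y)(y^* )\subset D^*_{\mathcal C_1}F_1(\bar x,\bar y_1)(y^* )+D^*_{\mathcal C_2}F_2(\bar x,\bar y_2)(y^* )\qquad\forall y^*\in\mathbb R^m.$$ (ii) Suppose that for every $(\bar y_1,\bar y_2)\in S(\bar x,\bar y)$ conditions ($q_1$) and ($q_2$) hold and $\operatorname{gph}F_i$ is locally closed around $(\bar x,\bar y_i)$, $i=1,2$. If $F_1$ and $F_2$ are closed-graph with respect to $\mathcal C$ at every $x\in\mathcal C$ near $\bar x$, and $S$ is inner semicompact at $(\bar x,\bar y)$ with respect to $\mathcal C\times\mathbb R^m$, then for all $y^*\in\mathbb R^m$ $$D^*_{\mathcal C}(F_1+F_2)(\bar x,\bar y)(y^* )\subset\bigcup_{(\bar y_1,\bar y_2)\in S(\bar x,\bar y)}\left[D^*_{\mathcal C_1}F_1(\bar x,\bar y_1)(y^* )+D^*_{\mathcal C_2}F_2(\bar x,\bar y_2)(y^* )\right].$$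
   Context: All spaces are finite-dimensional with scalar product $\langle\cdot,\cdot\rangle$ and a norm; on a product the norm is the sum of the norms. $x_k\xrightarrow{A}\bar x$ means $x_k\to\bar x$ with $x_k\in A$ for all $k$. $\operatorname{bd}$ denotes boundary. A set is locally closed around a point if its intersection with every sufficiently small closed ball centered at the point is closed. $\operatorname{gph}F:=\{(x,y)\mid y\in F(x)\}$, $\operatorname{dom}F:=\{x\mid F(x)\ne\emptyset\}$; $(F_1+F_2)(x):=\{y_1+y_2\mid y_i\in F_i(x)\}$. For a multifunction $M$ and a set $\mathcal D$ in its domain space: $M$ is inner semicompact with respect to $\mathcal D$ at $\bar u$ if for any $u_k\xrightarrow{\mathcal D}\bar u$ there is a sequence $v_k\in M(u_k)$ containing a convergent subsequence; $M$ is inner semicontinuous with respect to $\mathcal D$ at $(\bar u,\bar v)$ if for any $u_k\xrightarrow{\operatorname{dom}M\cap\mathcal D}\bar u$ there are $v_k\in M(u_k)$ with $v_k\to\bar v$; $M$ is closed-graph with respect to $\mathcal D$ at $\bar u$ if $\bar v\in M(\bar u)$ whenever $u_k\xrightarrow{\mathcal D}\bar u$, $v_k\to\bar v$, $v_k\in M(u_k)$. For a closed convex set $\mathcal C$ and $\bar x\in\mathcal C$, put $\mathcal R(\bar x,\mathcal C):=\{x^*\mid\exists p>0:\ \bar x+px^*\in\mathcal C\}$. For a set $\Omega$ and $\bar x\in\Omega$, the Fréchet normal cone is $\hat N(\bar x,\Omega):=\{x^*\mid\limsup_{x\xrightarrow{\Omega}\bar x}\frac{\langle x^*,x-\bar x\rangle}{\|x-\bar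 x\|}\le0\}$ (limsup over $x\ne\bar x$; i.e. for every $\epsilon>0$ there is $\delta>0$ with $\langle x^*,x-\bar x\rangle\le\epsilon\|x-\bar x\|$ for all $x\in\Omega$, $\|x-\bar x\|\le\delta$). For $\bar x\in\Omega\cap\mathcal C$, the Fréchet normal cone to $\Omega$ at $\bar x$ with respect to $\mathcal C$ is $$\hat N_{\mathcal C}(\bar x,\Omega):=\Big\{x^*\mid\exists p>0:\ \bar x+px^*\in\mathcal C,\ \limsup_{x\xrightarrow{\Omega\cap\mathcal C}\bar x}\tfrac{\langle x^*,x-\bar x\rangle}{\|x-\bar x\|}\le0\Big\},$$ and the limiting normal cone with respect to $\mathcal C$, $N_{\mathcal C}(\bar x,\Omega)$, is the set of all $x^*$ for which there are $x_k\xrightarrow{\Omega\cap\mathcal C}\bar x$ and $x_k^*\in\hat N_{\mathcal C}(x_k,\Omega)$ with $x_k^*\to x^*$. $F_{\mathcal C}(x):=F(x)$ if $x\in\mathcal C$, $\emptyset$ otherwise. For $(\bar x,\bar y)\in\operatorname{gph}F$ with $\bar x\in\mathcal C$, the limiting coderivative with respect to $\mathcal C$ is $D^*_{\mathcal C}F(\bar x,\bar y)(y^* ):=\{x^*\mid(x^*,-y^* )\in N_{\mathcal C\times\mathbb R^m}((\bar x,\bar y),\operatorname{gph}F_{\mathcal C})\}$. Normal-densed: for sets $\Omega_1,\Omega_2$ and closed convex sets $\mathcal D_1,\mathcal D_2$, with $\Omega:=\Omega_1\cap\Omega_2$, $\mathcal D:=\mathcal D_1\cap\mathcal D_2$ and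 $\bar w\in\Omega\cap\mathcal D$, $\{\Omega_1,\Omega_2\}$ are normal-densed in $\{\mathcal D_1,\mathcal D_2\}$ at $\bar w$ if, whenever there are sequences $w_{ik}\xrightarrow{\Omega_i\cap\mathcal D_i}\bar w$, $w_k\xrightarrow{\Omega\cap\operatorname{bd}\mathcal D}\bar w$, $w_{ik}^*\in\hat N(w_{ik},\Omega_i\cap\mathcal D_i)$ ($i=1,2$), $w_k^*\in\mathcal R(w_k,\mathcal D)$ with $w_{ik}^*\to w_i^*$ for some $w_i^*$ ($i=1,2$) and $w_k^*\to w_1^*+w_2^*$, there exist sequences $\tilde w_{ik}\xrightarrow{\Omega_i\cap\mathcal D_i}\bar w$ and $\tilde w_{ik}^*\in\hat N_{\mathcal D_i}(\tilde w_{ik},\Omega_i)$ with $\tilde w_{ik}^*\to\tilde w_i^*$ for some $\tilde w_i^*$ ($i=1,2$), such that $\tilde w_1^*+\tilde w_2^*=w_1^*+w_2^*$, and $\max\{\|\tilde w_1^*\|,\|\tilde w_2^*\|\}>0$ whenever $\max\{\|w_1^*\|,\|w_2^*\|\}>0$. *)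

theory Defs
  imports "HOL-Analysis.Analysis" "HOL-Library.Set_Algebras"
begin

type_synonym ('a, 'b) multifun = "'a \<Rightarrow> 'b set"

definition gph :: "('a, 'b) multifun \<Rightarrow> ('a \<times> 'b) set" where
  "gph F = {(x, y). y \<in> F x}"

definition mdom :: "('a, 'b) multifun \<Rightarrow> 'a set" where
  "mdom F = {x. F x \<noteq> {}}"

definition mrestrict :: "('a, 'b) multifun \<Rightarrow> 'a set \<Rightarrow> ('a, 'b) multifun" where
  "mrestrict F C = (\<lambda>x. if x \<in> C then F x else {})"

text \<open>The right-hand side is the Minkowski sum of two sets.\<close>

definition msum :: "('a, 'b::plus) multifun \<Rightarrow> ('a, 'b) multifun \<Rightarrow> ('a, 'b) multifun" where
  "msum F\<^sub>1 F\<^sub>2 = (\<lambda>x. F\<^sub>1 x + F\<^sub>2 x)"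

definition tends_in :: "(nat \<Rightarrow> 'a::topological_space) \<Rightarrow> 'a set \<Rightarrow> 'a \<Rightarrow> bool" where
  "tends_in u A l \<longleftrightarrow> (\<forall>k. u k \<in> A) \<and> u \<longlonglongrightarrow> l"

definition locally_closed_around :: "'a::metric_space set \<Rightarrow> 'a \<Rightarrow> bool" where
  "locally_closed_around A p \<longleftrightarrow> (\<exists>r>0. \<forall>s. 0 < s \<and> s \<le> r \<longrightarrow> closed (A \<inter> cball p s))"

text \<open>Every \<open>u\<close> in \<open>D\<close> tending to the reference point is tested, not only those in the
  domain of \<open>M\<close>; in particular \<open>M\<close> has nonempty values on \<open>D\<close> near that point.\<close>

definition inner_semicompact ::
  "('a::topological_space, 'b::topological_space) multifun \<Rightarrow> 'a set \<Rightarrow> 'a \<Rightarrow> bool" where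
  "inner_semicompact M D ub \<longleftrightarrow>
    (\<forall>u. tends_in u D ub \<longrightarrow>
      (\<exists>v. (\<forall>k. v k \<in> M (u k)) \<and> (\<exists>r l. strict_mono (r :: nat \<Rightarrow> nat) \<and> (v \<circ> r) \<longlonglongrightarrow> l)))"

definition inner_semicontinuous ::
  "('a::topological_space, 'b::topological_space) multifun \<Rightarrow> 'a set \<Rightarrow> 'a \<Rightarrow> 'b \<Rightarrow> bool" where
  "inner_semicontinuous M D ub vb \<longleftrightarrow>
    (\<forall>u. tends_in u (mdom M \<inter> D) ub \<longrightarrow> (\<exists>v. (\<forall>k. v k \<in> M (u k)) \<and> v \<longlonglongrightarrow> vb))"

definition closed_graph_at ::
  "('a::topological_space, 'b::topological_space) multifun \<Rightarrow> 'a set \<Rightarrow> 'a \<Rightarrow> bool" where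
  "closed_graph_at M D ub \<longleftrightarrow>
    (\<forall>u v vb. tends_in u D ub \<and> v \<longlonglongrightarrow> vb \<and> (\<forall>k. v k \<in> M (u k)) \<longrightarrow> vb \<in> M ub)"

definition radial_directions :: "'a::real_vector \<Rightarrow> 'a set \<Rightarrow> 'a set" where
  "radial_directions x C = {xs. \<exists>p>0. x + p *\<^sub>R xs \<in> C}"

text \<open>The upper limit is taken in the extended reals over \<open>z \<noteq> x\<close>; it is \<open>-\<infinity>\<close>
  when \<open>x\<close> is isolated in \<open>\<Omega>\<close>. On a product the library norm is the Euclidean one;
  replacing it by the sum of the norms, or by any other equivalent norm, gives the same cone:
  see \<open>frechet_normal_cone_iff\<close> below.\<close>

definition frechet_normal_cone :: "'a::real_inner \<Rightarrow> 'a set \<Rightarrow> 'a set" where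
  "frechet_normal_cone x \<Omega> =
    {xs. Limsup (at x within \<Omega>) (\<lambda>z. ereal (inner xs (z - x) / norm (z - x))) \<le> 0}"

definition frechet_normal_cone_wrt :: "'a::real_inner set \<Rightarrow> 'a \<Rightarrow> 'a set \<Rightarrow> 'a set" where
  "frechet_normal_cone_wrt C x \<Omega> = radial_directions x C \<inter> frechet_normal_cone x (\<Omega> \<inter> C)"

definition limiting_normal_cone_wrt :: "'a::real_inner set \<Rightarrow> 'a \<Rightarrow> 'a set \<Rightarrow> 'a set" where
  "limiting_normal_cone_wrt C x \<Omega> =
    {xs. \<exists>u us. tends_in u (\<Omega> \<inter> C) x \<and> (\<forall>k. us k \<in> frechet_normal_cone_wrt C (u k) \<Omega>) \<and>
       us \<longlonglongrightarrow> xs}"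

definition coderivative_wrt ::
  "'a::real_inner set \<Rightarrow> ('a, 'b::real_inner) multifun \<Rightarrow> 'a \<Rightarrow> 'b \<Rightarrow> 'b \<Rightarrow> 'a set" where
  "coderivative_wrt C F x y ys =
    {xs. (xs, - ys) \<in> limiting_normal_cone_wrt (C \<times> UNIV) (x, y) (gph (mrestrict F C))}"

definition normal_densed ::
  "'a::real_inner set \<Rightarrow> 'a set \<Rightarrow> 'a set \<Rightarrow> 'a set \<Rightarrow> 'a \<Rightarrow> bool" where
  "normal_densed \<Omega>\<^sub>1 \<Omega>\<^sub>2 D\<^sub>1 D\<^sub>2 wb \<longleftrightarrow>
    (\<forall>u\<^sub>1 u\<^sub>2 u us\<^sub>1 us\<^sub>2 us ws\<^sub>1 ws\<^sub>2.
       tends_in u\<^sub>1 (\<Omega>\<^sub>1 \<inter> D\<^sub>1) wb \<and> tends_in u\<^sub>2 (\<Omega>\<^sub>2 \<inter> D\<^sub>2) wb \<and>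
       tends_in u ((\<Omega>\<^sub>1 \<inter> \<Omega>\<^sub>2) \<inter> frontier (D\<^sub>1 \<inter> D\<^sub>2)) wb \<and>
       (\<forall>k. us\<^sub>1 k \<in> frechet_normal_cone (u\<^sub>1 k) (\<Omega>\<^sub>1 \<inter> D\<^sub>1)) \<and>
       (\<forall>k. us\<^sub>2 k \<in> frechet_normal_cone (u\<^sub>2 k) (\<Omega>\<^sub>2 \<inter> D\<^sub>2)) \<and>
       (\<forall>k. us k \<in> radial_directions (u k) (D\<^sub>1 \<inter> D\<^sub>2)) \<and>
       us\<^sub>1 \<longlonglongrightarrow> ws\<^sub>1 \<and> us\<^sub>2 \<longlonglongrightarrow> ws\<^sub>2 \<and> us \<longlonglongrightarrow> ws\<^sub>1 + ws\<^sub>2 \<longrightarrow>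
       (\<exists>t\<^sub>1 t\<^sub>2 ts\<^sub>1 ts\<^sub>2 vs\<^sub>1 vs\<^sub>2.
          tends_in t\<^sub>1 (\<Omega>\<^sub>1 \<inter> D\<^sub>1) wb \<and> tends_in t\<^sub>2 (\<Omega>\<^sub>2 \<inter> D\<^sub>2) wb \<and>
          (\<forall>k. ts\<^sub>1 k \<in> frechet_normal_cone_wrt D\<^sub>1 (t\<^sub>1 k) \<Omega>\<^sub>1) \<and>
          (\<forall>k. ts\<^sub>2 k \<in> frechet_normal_cone_wrt D\<^sub>2 (t\<^sub>2 k) \<Omega>\<^sub>2) \<and>
          ts\<^sub>1 \<longlonglongrightarrow> vs\<^sub>1 \<and> ts\<^sub>2 \<longlonglongrightarrow> vs\<^sub>2 \<and>
          vs\<^sub>1 + vs\<^sub>2 = ws\<^sub>1 + ws\<^sub>2 \<and>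
          (max (norm ws\<^sub>1) (norm ws\<^sub>2) > 0 \<longrightarrow> max (norm vs\<^sub>1) (norm vs\<^sub>2) > 0)))"

definition sum_splitting ::
  "('a, 'b::plus) multifun \<Rightarrow> ('a, 'b) multifun \<Rightarrow> ('a \<times> 'b, 'b \<times> 'b) multifun" where
  "sum_splitting F\<^sub>1 F\<^sub>2 = (\<lambda>(x, y). {(y\<^sub>1, y\<^sub>2). y\<^sub>1 \<in> F\<^sub>1 x \<and> y\<^sub>2 \<in> F\<^sub>2 x \<and> y\<^sub>1 + y\<^sub>2 = y})"

definition graph_lift1 :: "('a, 'b) multifun \<Rightarrow> ('a \<times> 'b \<times> 'b) set" where
  "graph_lift1 F = {(x, y\<^sub>1, y\<^sub>2). (x, y\<^sub>1) \<in> gph F}"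

definition graph_lift2 :: "('a, 'b) multifun \<Rightarrow> ('a \<times> 'b \<times> 'b) set" where
  "graph_lift2 F = {(x, y\<^sub>1, y\<^sub>2). (x, y\<^sub>2) \<in> gph F}"

text \<open>The unary minus on a set of type \<open>'a set\<close> is the complement, so the reflected
  coderivative is written as an image.\<close>

definition coderivative_qualification ::
  "'a::real_inner set \<Rightarrow> 'a set \<Rightarrow> ('a, 'b::real_inner) multifun \<Rightarrow> ('a, 'b) multifun \<Rightarrow>
   'a \<Rightarrow> 'b \<Rightarrow> 'b \<Rightarrow> bool" where
  "coderivative_qualification C\<^sub>1 C\<^sub>2 F\<^sub>1 F\<^sub>2 x y\<^sub>1 y\<^sub>2 \<longleftrightarrow>
    coderivative_wrt C\<^sub>1 F\<^sub>1 x y\<^sub>1 0 \<inter> uminus ` coderivative_wrt C\<^sub>2 F\<^sub>2 x y\<^sub>2 0 = {0}"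

definition normal_densed_qualification ::
  "'a::real_inner set \<Rightarrow> 'a set \<Rightarrow> ('a, 'b::real_inner) multifun \<Rightarrow> ('a, 'b) multifun \<Rightarrow>
   'a \<Rightarrow> 'b \<Rightarrow> 'b \<Rightarrow> bool" where
  "normal_densed_qualification C\<^sub>1 C\<^sub>2 F\<^sub>1 F\<^sub>2 x y\<^sub>1 y\<^sub>2 \<longleftrightarrow>
    normal_densed (graph_lift1 F\<^sub>1) (graph_lift2 F\<^sub>2) (C\<^sub>1 \<times> UNIV) (C\<^sub>2 \<times> UNIV) (x, y\<^sub>1, y\<^sub>2)"

text \<open>For the library norm (\<open>N = norm\<close>) this is the usual epsilon-delta form.\<close>

lemma frechet_normal_cone_iff:
  fixes N :: "'a::real_inner \<Rightarrow> real"
  assumes c: "c > 0" and lo: "\<And>z. c * norm z \<le> N z" and up: "\<And>z. N z \<le> K * norm z"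
  shows "xs \<in> frechet_normal_cone x \<Omega> \<longleftrightarrow>
    (\<forall>\<epsilon>>0. \<exists>\<delta>>0. \<forall>z\<in>\<Omega>. N (z - x) \<le> \<delta> \<longrightarrow> inner xs (z - x) \<le> \<epsilon> * N (z - x))"
    (is "_ \<longleftrightarrow> ?R")
proof
  define K' where "K' = max K 1"
  have K': "K' > 0" and up': "N z \<le> K' * norm z" for z
    using up[of z] mult_right_mono[of K K' "norm z"] by (auto simp: K'_def)
  have L: "xs \<in> frechet_normal_cone x \<Omega> \<longleftrightarrow>
    (\<forall>y>0. eventually (\<lambda>z. ereal (inner xs (z - x) / norm (z - x)) < y) (at x within \<Omega>))"
    unfolding frechet_normal_cone_def by (simp add: Limsup_le_iff)
  {
    assume A: "xs \<in> frechet_normal_cone x \<Omega>"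
    show ?R
    proof (intro allI impI)
      fix \<epsilon> :: real assume e: "\<epsilon> > 0"
      have "eventually (\<lambda>z. ereal (inner xs (z - x) / norm (z - x)) < ereal (\<epsilon> * c)) (at x within \<Omega>)"
        using A e c unfolding L by (simp only: ereal_less(2) mult_pos_pos)
      then obtain d where d: "d > 0" and
        D: "\<And>z. z \<in> \<Omega> \<Longrightarrow> z \<noteq> x \<Longrightarrow> dist z x < d \<Longrightarrow> inner xs (z - x) / norm (z - x) < \<epsilon> * c"
        unfolding eventually_at by auto
      have "inner xs (z - x) \<le> \<epsilon> * N (z - x)" if z: "z \<in> \<Omega>" "N (z - x) \<le> c * d / 2" for z
      proof (cases "z = x")
        case True
        then show ?thesis using lo[of 0] e by simp
      next
        case False
        have "c * norm (z - x) \<le> c * (d / 2)" using lo[of "z - x"] z by simp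
        then have "norm (z - x) \<le> d / 2" using c by simp
        then have "dist z x < d" using d by (simp add: dist_norm)
        from D[OF z(1) False this] have "inner xs (z - x) \<le> \<epsilon> * (c * norm (z - x))"
          using False by (simp add: pos_divide_less_eq mult.assoc less_imp_le)
        also have "\<dots> \<le> \<epsilon> * N (z - x)" using lo[of "z - x"] e by simp
        finally show ?thesis .
      qed
      then show "\<exists>\<delta>>0. \<forall>z\<in>\<Omega>. N (z - x) \<le> \<delta> \<longrightarrow> inner xs (z - x) \<le> \<epsilon> * N (z - x)"
        using c d by (intro exI[of _ "c * d / 2"]) auto
    qed
  }
  {
    assume R: ?R
    show "xs \<in> frechet_normal_cone x \<Omega>"
      unfolding L
    proof (intro allI impI)
      fix y :: ereal assume "y > 0"
      then obtain e where e: "e > 0" "ereal e < y"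
        using ereal_dense2[of 0 y] by (auto simp: zero_ereal_def)
      obtain d where d: "d > 0" and
        D: "\<And>z. z \<in> \<Omega> \<Longrightarrow> N (z - x) \<le> d \<Longrightarrow> inner xs (z - x) \<le> e / K' * N (z - x)"
        using R[rule_format, OF divide_pos_pos[OF e(1) K']] by blast
      have "inner xs (z - x) / norm (z - x) \<le> e" if z: "z \<in> \<Omega>" "z \<noteq> x" "dist z x < d / K'" for z
      proof -
        have "K' * norm (z - x) \<le> d" using z(3) K' by (simp add: dist_norm field_simps)
        then have "N (z - x) \<le> d" using up'[of "z - x"] by simp
        from D[OF z(1) this] have "inner xs (z - x) \<le> e / K' * N (z - x)" .
        also have "\<dots> \<le> e / K' * (K' * norm (z - x))"
          by (rule mult_left_mono[OF up']) (use e K' in auto)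
        also have "\<dots> = e * norm (z - x)" using K' by simp
        finally show ?thesis using z(2) by (simp add: pos_divide_le_eq)
      qed
      then have "ereal (inner xs (z - x) / norm (z - x)) < y"
        if "z \<in> \<Omega>" "z \<noteq> x" "dist z x < d / K'" for z
        using that by (intro le_less_trans[OF _ e(2)]) simp
      moreover have "d / K' > 0" using d K' by simp
      ultimately show
        "eventually (\<lambda>z. ereal (inner xs (z - x) / norm (z - x)) < y) (at x within \<Omega>)"
        unfolding eventually_at by blast
    qed
  }
qed

lemma locally_closed_around_iff:
  fixes N :: "'a::real_normed_vector \<Rightarrow> real"
  assumes c: "c > 0" and lo: "\<And>z. c * norm z \<le> N z" and up: "\<And>z. N z \<le> K * norm z"
    and cont: "continuous_on UNIV N"
  shows "locally_closed_around A p \<longleftrightarrow>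
    (\<exists>r>0. \<forall>s. 0 < s \<and> s \<le> r \<longrightarrow> closed (A \<inter> {z. N (z - p) \<le> s}))"
    (is "_ \<longleftrightarrow> ?R")
proof
  define K' where "K' = max K 1"
  have K': "K' > 0" and up': "N z \<le> K' * norm z" for z
    using up[of z] mult_right_mono[of K K' "norm z"] by (auto simp: K'_def)
  have clN: "closed {z. N (z - p) \<le> s}" for s
    by (intro closed_Collect_le continuous_on_const continuous_on_compose2[OF cont] continuous_intros) auto
  {
    assume "locally_closed_around A p"
    then obtain r where r: "r > 0" "closed (A \<inter> cball p r)"
      unfolding locally_closed_around_def by blast
    have "closed (A \<inter> {z. N (z - p) \<le> s})" if s: "s \<le> c * r" for s
    proof -
      have "z \<in> cball p r" if "N (z - p) \<le> s" for z
      proof -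
        have "c * norm (z - p) \<le> c * r" using lo[of "z - p"] that s by simp
        then show ?thesis using c by (simp add: dist_norm norm_minus_commute)
      qed
      then have "A \<inter> {z. N (z - p) \<le> s} = (A \<inter> cball p r) \<inter> {z. N (z - p) \<le> s}" by blast
      then show ?thesis using r(2) clN by (metis closed_Int)
    qed
    then show ?R using c r(1) by (intro exI[of _ "c * r"]) auto
  }
  {
    assume ?R
    then obtain r where r: "r > 0" "closed (A \<inter> {z. N (z - p) \<le> r})" by blast
    have "closed (A \<inter> cball p s)" if s: "s \<le> r / K'" for s
    proof -
      have "N (z - p) \<le> r" if "z \<in> cball p s" for z
      proof -
        have "norm (z - p) \<le> r / K'"
          using that s by (simp add: dist_norm norm_minus_commute)
        then have "K' * norm (z - p) \<le> r" using K' by (simp add: pos_le_divide_eq mult.commute)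
        then show ?thesis using up'[of "z - p"] by simp
      qed
      then have "A \<inter> cball p s = (A \<inter> {z. N (z - p) \<le> r}) \<inter> cball p s" by blast
      then show ?thesis using r(2) by (metis closed_Int closed_cball)
    qed
    then show "locally_closed_around A p"
      unfolding locally_closed_around_def using K' r(1) by (intro exI[of _ "r / K'"]) auto
  }
qed

text \<open>The sum norms on \<open>'a \<times> 'b\<close> and \<open>'a \<times> 'b \<times> 'c\<close> satisfy the hypotheses of the two
  lemmas above.\<close>

lemma sum_norm_bounds:
  fixes z :: "'a::real_normed_vector \<times> 'b::real_normed_vector"
  shows "1 * norm z \<le> norm (fst z) + norm (snd z)"
    and "norm (fst z) + norm (snd z) \<le> 2 * norm z"
    and "continuous_on UNIV (\<lambda>z :: 'a \<times> 'b. norm (fst z) + norm (snd z))"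
  using norm_Pair_le[of "fst z" "snd z"] norm_fst_le[of "fst z" "snd z"]
    norm_snd_le[of "snd z" "fst z"] by (auto intro!: continuous_intros)

lemma sum_norm3_bounds:
  fixes z :: "'a::real_normed_vector \<times> 'b::real_normed_vector \<times> 'c::real_normed_vector"
  shows "1 * norm z \<le> norm (fst z) + norm (fst (snd z)) + norm (snd (snd z))"
    and "norm (fst z) + norm (fst (snd z)) + norm (snd (snd z)) \<le> 3 * norm z"
    and "continuous_on UNIV
      (\<lambda>z :: 'a \<times> 'b \<times> 'c. norm (fst z) + norm (fst (snd z)) + norm (snd (snd z)))"
proof -
  obtain x y w where z: "z = (x, y, w)" by (metis prod_cases3)
  show "1 * norm z \<le> norm (fst z) + norm (fst (snd z)) + norm (snd (snd z))"
    using norm_Pair_le[of x "(y, w)"] norm_Pair_le[of y w] by (simp add: z)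
  have "norm x \<le> norm z" "norm (y, w) \<le> norm z"
    using norm_fst_le[of x "(y, w)"] norm_snd_le[of "(y, w)" x] by (simp_all add: z)
  then show "norm (fst z) + norm (fst (snd z)) + norm (snd (snd z)) \<le> 3 * norm z"
    using norm_fst_le[of y w] norm_snd_le[of w y] by (simp add: z)
qed (intro continuous_intros)

end

theory Submission
  imports Defs
begin

text \<open>A Frechet normal to the graph of the restricted sum at \<open>(x, y\<^sub>1 + y\<^sub>2)\<close> pulls back along
  \<open>(x, y\<^sub>1, y\<^sub>2) \<mapsto> (x, y\<^sub>1 + y\<^sub>2)\<close> to a normal to \<open>\<Omega>\<^sub>1 \<inter> \<Omega>\<^sub>2\<close> with respect to \<open>C \<times> UNIV\<close>.
  A fuzzy intersection rule splits it into nearby normals to \<open>\<Omega>\<^sub>i \<inter> D\<^sub>i\<close>. At interior points of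
  \<open>D\<^sub>1 \<inter> D\<^sub>2\<close> the radial condition on these is void; at boundary points the normal-densedness
  property replaces them by normals with respect to \<open>D\<^sub>i\<close> with the same sum. In the limit this
  gives \<open>l \<cdot> x\<^sup>* = v\<^sub>1 + v\<^sub>2\<close> with \<open>l \<ge> 0\<close>, not all of \<open>l, v\<^sub>1, v\<^sub>2\<close> being zero. Since normals to
  \<open>\<Omega>\<^sub>1\<close> and \<open>\<Omega>\<^sub>2\<close> vanish in the third and second component, \<open>l = 0\<close> would contradict the
  coderivative qualification.\<close>

section \<open>Calculus of Frechet normal cones\<close>

lemma frechet_normal_cone_norm_iff:
  "xs \<in> frechet_normal_cone x \<Omega> \<longleftrightarrow>
    (\<forall>\<epsilon>>0. \<exists>\<delta>>0. \<forall>z\<in>\<Omega>. norm (z - x) \<le> \<delta> \<longrightarrow> inner xs (z - x) \<le> \<epsilon> * norm (z - x))"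
  by (rule frechet_normal_cone_iff[of 1 norm 1]) auto

lemma frechet_normal_cone_scaleR:
  assumes "xs \<in> frechet_normal_cone x \<Omega>" "c \<ge> 0"
  shows "c *\<^sub>R xs \<in> frechet_normal_cone x \<Omega>"
proof (cases "c = 0")
  case True
  then show ?thesis
    unfolding frechet_normal_cone_norm_iff by (auto intro: exI[of _ 1])
next
  case False
  with assms(2) have c: "c > 0" by simp
  show ?thesis
    unfolding frechet_normal_cone_norm_iff
  proof (intro allI impI)
    fix \<epsilon> :: real
    assume "\<epsilon> > 0"
    with c have "\<epsilon> / c > 0" by simp
    then obtain \<delta> where "\<delta> > 0"
      and \<delta>: "\<And>z. z \<in> \<Omega> \<Longrightarrow> norm (z - x) \<le> \<delta> \<Longrightarrow> inner xs (z - x) \<le> \<epsilon> / c * norm (z - x)"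
      using assms(1) unfolding frechet_normal_cone_norm_iff by blast
    have "inner (c *\<^sub>R xs) (z - x) \<le> \<epsilon> * norm (z - x)" if "z \<in> \<Omega>" "norm (z - x) \<le> \<delta>" for z
      using mult_left_mono[OF \<delta>[OF that], of c] c by simp
    with \<open>\<delta> > 0\<close> show "\<exists>\<delta>>0. \<forall>z\<in>\<Omega>. norm (z - x) \<le> \<delta> \<longrightarrow>
        inner (c *\<^sub>R xs) (z - x) \<le> \<epsilon> * norm (z - x)" by blast
  qed
qed

text \<open>A quadratic remainder is small compared with the distance to \<open>x\<close>.
  Optimality conditions of the penalty problem arrive in this shape.\<close>

lemma frechet_normal_coneI_quadratic:
  assumes "r > 0"
    and "\<And>z. z \<in> \<Omega> \<Longrightarrow> norm (z - x) \<le> r \<Longrightarrow> inner xs (z - x) \<le> M * (norm (z - x))\<^sup>2"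
  shows "xs \<in> frechet_normal_cone x \<Omega>"
  unfolding frechet_normal_cone_norm_iff
proof (intro allI impI)
  fix \<epsilon> :: real
  assume \<epsilon>: "\<epsilon> > 0"
  \<comment> \<open>The second entry makes \<open>M * norm (z - x)\<close> at most \<epsilon>; its
    denominator is positive whatever the sign of \<open>M\<close>.\<close>
  define \<delta> where "\<delta> = min r (\<epsilon> / (\<bar>M\<bar> + 1))"
  have "inner xs (z - x) \<le> \<epsilon> * norm (z - x)" if z: "z \<in> \<Omega>" "norm (z - x) \<le> \<delta>" for z
  proof -
    have "norm (z - x) * (\<bar>M\<bar> + 1) \<le> \<epsilon>"
      using z(2) by (simp add: \<delta>_def pos_le_divide_eq)
    moreover have "M * norm (z - x) \<le> norm (z - x) * (\<bar>M\<bar> + 1)"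
      by (subst mult.commute, rule mult_left_mono) auto
    ultimately have "M * norm (z - x) \<le> \<epsilon>" by linarith
    then have "M * norm (z - x) * norm (z - x) \<le> \<epsilon> * norm (z - x)"
      by (rule mult_right_mono) simp
    with assms(2)[of z] z show ?thesis
      by (simp add: \<delta>_def power2_eq_square mult.assoc)
  qed
  moreover have "\<delta> > 0" using \<epsilon> assms(1) by (auto simp: \<delta>_def)
  ultimately show "\<exists>\<delta>>0. \<forall>z\<in>\<Omega>. norm (z - x) \<le> \<delta> \<longrightarrow>
      inner xs (z - x) \<le> \<epsilon> * norm (z - x)" by blast
qed

text \<open>The Lipschitz bound at \<open>x\<close> turns an error small against
  \<open>norm (g z - g x)\<close> into one small against \<open>norm (z - x)\<close>, and
  \<open>adj\<close> makes \<open>xs'\<close> the adjoint image of \<open>xs\<close>. It serves both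
  for slices of lifted graphs and for the sum map.\<close>

lemma frechet_normal_cone_transfer:
  fixes g :: "'a::real_inner \<Rightarrow> 'b::real_inner"
  assumes xs: "xs \<in> frechet_normal_cone (g x) \<Omega>"
    and maps: "\<And>z. z \<in> \<Omega>' \<Longrightarrow> g z \<in> \<Omega>"
    and lip: "\<And>z. norm (g z - g x) \<le> K * norm (z - x)"
    and adj: "\<And>z. inner xs (g z - g x) = inner xs' (z - x)"
  shows "xs' \<in> frechet_normal_cone x \<Omega>'"
  unfolding frechet_normal_cone_norm_iff
proof (intro allI impI)
  fix \<epsilon> :: real
  assume \<epsilon>: "\<epsilon> > 0"
  \<comment> \<open>\<open>L\<close> is a positive Lipschitz constant even if \<open>K\<close> is
    not positive, so that \<epsilon> and \<delta> can be divided by it.\<close>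
  define L where "L = \<bar>K\<bar> + 1"
  have L: "L > 0" and lip': "norm (g z - g x) \<le> L * norm (z - x)" for z
    using order_trans[OF lip[of z] mult_right_mono[of K L "norm (z - x)"]] by (auto simp: L_def)
  from \<epsilon> L have "\<epsilon> / L > 0" by simp
  then obtain \<delta> where "\<delta> > 0" and \<delta>: "\<And>w. w \<in> \<Omega> \<Longrightarrow> norm (w - g x) \<le> \<delta> \<Longrightarrow>
      inner xs (w - g x) \<le> \<epsilon> / L * norm (w - g x)"
    using xs unfolding frechet_normal_cone_norm_iff by blast
  have "inner xs' (z - x) \<le> \<epsilon> * norm (z - x)" if z: "z \<in> \<Omega>'" "norm (z - x) \<le> \<delta> / L" for z
  proof -
    have "L * norm (z - x) \<le> \<delta>" using z(2) L by (simp add: field_simps)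
    with lip'[of z] have "norm (g z - g x) \<le> \<delta>" by linarith
    from \<delta>[OF maps[OF z(1)] this] adj
    have "inner xs' (z - x) \<le> \<epsilon> / L * norm (g z - g x)" by simp
    also have "\<dots> \<le> \<epsilon> / L * (L * norm (z - x))"
      by (rule mult_left_mono[OF lip']) (use \<epsilon> L in auto)
    also have "\<dots> = \<epsilon> * norm (z - x)" using L by simp
    finally show ?thesis .
  qed
  moreover have "\<delta> / L > 0" using \<open>\<delta> > 0\<close> L by simp
  ultimately show "\<exists>\<delta>>0. \<forall>z\<in>\<Omega>'. norm (z - x) \<le> \<delta> \<longrightarrow>
      inner xs' (z - x) \<le> \<epsilon> * norm (z - x)" by blast
qed

text \<open>In the whole space a normal can be tested in its own direction. This forces normals to
  vanish in coordinates that a set leaves free.\<close>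

lemma frechet_normal_cone_UNIV: "frechet_normal_cone x UNIV = {0}"
proof (intro equalityI subsetI)
  fix c
  assume c: "c \<in> frechet_normal_cone x UNIV"
  have "norm c \<le> 0 + \<epsilon>" if "\<epsilon> > 0" for \<epsilon>
  proof (cases "c = 0")
    case False
    obtain \<delta> where "\<delta> > 0" and \<delta>: "\<And>z. norm (z - x) \<le> \<delta> \<Longrightarrow> inner c (z - x) \<le> \<epsilon> * norm (z - x)"
      using c \<open>\<epsilon> > 0\<close> unfolding frechet_normal_cone_norm_iff by blast
    \<comment> \<open>The test point lies at distance exactly \<delta> from \<open>x\<close> in
      direction \<open>c\<close>, so the inequality says
      \<open>\<delta> * norm c \<le> \<epsilon> * \<delta>\<close>.\<close>
    have "(\<delta> / norm c) * (norm c * norm c) \<le> \<epsilon> * \<delta>"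
      using \<delta>[of "x + (\<delta> / norm c) *\<^sub>R c"] \<open>\<delta> > 0\<close> False
      by (simp flip: power2_eq_square power2_norm_eq_inner)
    with \<open>\<delta> > 0\<close> False show ?thesis by (simp add: field_simps)
  qed (use that in auto)
  then have "norm c \<le> 0" by (rule field_le_epsilon)
  then show "c \<in> {0}" by simp
next
  fix c :: 'a assume "c \<in> {0}"
  then show "c \<in> frechet_normal_cone x UNIV"
    unfolding frechet_normal_cone_norm_iff by (auto intro: exI[of _ 1])
qed

section \<open>Radial directions and scaling of normal cones with respect to a set\<close>

lemma radial_directions_scaleR:
  assumes "xs \<in> radial_directions x C" "x \<in> C" "c \<ge> 0"
  shows "c *\<^sub>R xs \<in> radial_directions x C"
proof (cases "c = 0")
  case True
  with assms(2) show ?thesis by (auto simp: radial_directions_def intro: exI[of _ 1])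
next
  case False
  obtain p where "p > 0" "x + p *\<^sub>R xs \<in> C" using assms(1) by (auto simp: radial_directions_def)
  with False assms(3) show ?thesis
    unfolding radial_directions_def by (auto intro!: exI[of _ "p / c"])
qed

text \<open>A short enough step in any direction stays in a ball inside \<open>C\<close>, so the
  radial condition is vacuous at interior points.\<close>

lemma radial_directions_interior:
  fixes x :: "'a::real_normed_vector"
  assumes "x \<in> interior C"
  shows "radial_directions x C = UNIV"
proof -
  obtain e where e: "e > 0" "ball x e \<subseteq> C" using assms mem_interior by blast
  have "xs \<in> radial_directions x C" for xs
  proof -
    \<comment> \<open>Adding 1 covers \<open>xs = 0\<close> and keeps the step strictly inside the
      open ball.\<close>
    define p where "p = e / (norm xs + 1)"
    have p: "p > 0" using e by (simp add: p_def add_nonneg_pos)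
    have "p * norm xs < p * (norm xs + 1)" using p by simp
    also have "\<dots> = e" by (simp add: p_def add_nonneg_eq_0_iff)
    finally have "x + p *\<^sub>R xs \<in> ball x e" using p by (simp add: dist_norm)
    with p e(2) show ?thesis unfolding radial_directions_def by blast
  qed
  then show ?thesis by blast
qed

lemma frechet_normal_cone_wrt_scaleR:
  assumes "xs \<in> frechet_normal_cone_wrt C x \<Omega>" "x \<in> C" "c \<ge> 0"
  shows "c *\<^sub>R xs \<in> frechet_normal_cone_wrt C x \<Omega>"
  using assms by (auto simp: frechet_normal_cone_wrt_def
      intro: radial_directions_scaleR frechet_normal_cone_scaleR)

lemma limiting_normal_cone_wrtI:
  assumes "tends_in u (\<Omega> \<inter> C) x" "\<And>k. us k \<in> frechet_normal_cone_wrt C (u k) \<Omega>" "us \<longlonglongrightarrow> xs"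
  shows "xs \<in> limiting_normal_cone_wrt C x \<Omega>"
  using assms unfolding limiting_normal_cone_wrt_def by blast

lemma limiting_normal_cone_wrt_scaleR:
  assumes "xs \<in> limiting_normal_cone_wrt C x \<Omega>" "c \<ge> 0"
  shows "c *\<^sub>R xs \<in> limiting_normal_cone_wrt C x \<Omega>"
proof -
  obtain u us where u: "tends_in u (\<Omega> \<inter> C) x" "us \<longlonglongrightarrow> xs"
    "\<And>k. us k \<in> frechet_normal_cone_wrt C (u k) \<Omega>"
    using assms(1) unfolding limiting_normal_cone_wrt_def by blast
  have "c *\<^sub>R us k \<in> frechet_normal_cone_wrt C (u k) \<Omega>" for k
    using u assms(2) by (intro frechet_normal_cone_wrt_scaleR) (auto simp: tends_in_def)
  moreover have "(\<lambda>k. c *\<^sub>R us k) \<longlonglongrightarrow> c *\<^sub>R xs"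
    by (intro tendsto_intros u)
  ultimately show ?thesis
    by (rule limiting_normal_cone_wrtI[OF u(1)])
qed

section \<open>Fuzzy intersection rule for Frechet normals\<close>

text \<open>Comparing a minimiser \<open>a\<close> with a competitor \<open>v\<close>, this
  separates the linear term, which yields the normal, from the quadratic remainder.\<close>

lemma norm_diff_square_shift:
  fixes v a x :: "'a::real_inner"
  shows "(norm (v - x))\<^sup>2 = (norm (a - x))\<^sup>2 + 2 * inner (a - x) (v - a) + (norm (v - a))\<^sup>2"
  unfolding power2_norm_eq_inner by (simp add: inner_simps inner_commute algebra_simps)

text \<open>A penalty argument: minimise
  \<open>- \<langle>xs, a - x\<rangle> + c \<parallel>a - x\<parallel>\<^sup>2 + j \<parallel>a - b\<parallel>\<^sup>2\<close> over \<open>a \<in> A\<close>, \<open>b \<in> B\<close> near \<open>x\<close> for large \<open>j\<close>;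
  the optimality conditions in \<open>a\<close> and \<open>b\<close> are the two normals. With \<open>c = \<epsilon> / \<eta>\<close> every limit
  point of the minimisers lies within \<open>\<eta> / 2\<close> of \<open>x\<close>, so the error \<open>2 c (a - x)\<close> is below \<open>2 \<epsilon>\<close>.\<close>

lemma fuzzy_intersection_rule:
  fixes A B :: "'a::euclidean_space set"
  assumes clA: "closed (A \<inter> cball w r)" and clB: "closed (B \<inter> cball w r)" and xw: "dist x w < r"
    and x: "x \<in> A \<inter> B" and xs: "xs \<in> frechet_normal_cone x (A \<inter> B)" and \<delta>: "\<delta> > 0"
  shows "\<exists>a b as bs. a \<in> A \<and> b \<in> B \<and> dist a x < \<delta> \<and> dist b x < \<delta> \<and>
    as \<in> frechet_normal_cone a A \<and> bs \<in> frechet_normal_cone b B \<and> norm (xs - (as + bs)) < \<delta>"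
proof -
  define \<epsilon> where "\<epsilon> = \<delta> / 2"
  have \<epsilon>: "\<epsilon> > 0" using \<delta> by (simp add: \<epsilon>_def)
  \<comment> \<open>The factor one half leaves a gap: a limit point at distance at least \<eta> from
    \<open>x\<close> would need \<open>c\<close> times that distance to be both at least \<epsilon>
    and at most \<open>\<epsilon> / 2\<close>.\<close>
  obtain d where d: "d > 0" "\<And>z. z \<in> A \<inter> B \<Longrightarrow> norm (z - x) \<le> d \<Longrightarrow>
      inner xs (z - x) \<le> \<epsilon> / 2 * norm (z - x)"
    using xs \<epsilon> unfolding frechet_normal_cone_norm_iff by (meson half_gt_zero)
  \<comment> \<open>Small enough for the normal inequality, and for the ball to stay in
    \<open>cball w r\<close>, where closedness gives compactness.\<close>
  define s where "s = min d (r - dist x w)"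
  have s: "s > 0" "s \<le> d" using d xw by (auto simp: s_def)
  have sub: "cball x s \<subseteq> cball w r"
  proof
    fix z assume "z \<in> cball x s"
    then show "z \<in> cball w r"
      using dist_triangle[of w z x] by (simp add: s_def dist_commute)
  qed
  define X where "X = A \<inter> cball x s"
  define Y where "Y = B \<inter> cball x s"
  have "X = (A \<inter> cball w r) \<inter> cball x s" "Y = (B \<inter> cball w r) \<inter> cball x s"
    using sub by (auto simp: X_def Y_def)
  then have cX: "compact X" and cY: "compact Y"
    using clA clB by (metis closed_Int_compact compact_cball)+
  define \<eta> where "\<eta> = min \<delta> s"
  have \<eta>: "\<eta> > 0" "\<eta> \<le> \<delta>" "\<eta> \<le> s" using \<delta> s by (auto simp: \<eta>_def)
  define c where "c = \<epsilon> / \<eta>"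
  have c: "c > 0" using \<epsilon> \<eta> by (simp add: c_def)
  define f where "f = (\<lambda>(j::nat) (a, b). - inner xs (a - x) + c * (norm (a - x))\<^sup>2 + j * (norm (a - b))\<^sup>2)"
  have "x \<in> X" "x \<in> Y" using x s by (auto simp: X_def Y_def)
  have "\<exists>q. q \<in> X \<times> Y \<and> (\<forall>z\<in>X \<times> Y. f j q \<le> f j z)" for j
  proof -
    have "continuous_on (X \<times> Y) (f j)"
      unfolding f_def case_prod_unfold by (intro continuous_intros)
    moreover have "compact (X \<times> Y)" using cX cY by (rule compact_Times)
    moreover have "X \<times> Y \<noteq> {}" using \<open>x \<in> X\<close> \<open>x \<in> Y\<close> by auto
    ultimately show ?thesis using continuous_attains_inf by blast
  qed
  then obtain q where q: "\<And>j. q j \<in> X \<times> Y" "\<And>j z. z \<in> X \<times> Y \<Longrightarrow> f j (q j) \<le> f j z"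
    by metis
  obtain l \<rho> where l: "l \<in> X \<times> Y" "strict_mono \<rho>" "(q \<circ> \<rho>) \<longlonglongrightarrow> l"
    using compact_Times[OF cX cY] q(1) unfolding compact_def by metis
  define a where "a j = fst (q (\<rho> j))" for j
  define b where "b j = snd (q (\<rho> j))" for j
  have lim_a: "a \<longlonglongrightarrow> fst l" and lim_b: "b \<longlonglongrightarrow> snd l"
    using tendsto_fst[OF l(3)] tendsto_snd[OF l(3)] by (simp_all add: a_def[abs_def] b_def[abs_def] o_def)
  have ab: "a j \<in> X" "b j \<in> Y" for j
    using q(1)[of "\<rho> j"] by (auto simp: a_def b_def mem_Times_iff)
  have min: "f (\<rho> j) (a j, b j) \<le> f (\<rho> j) z" if "z \<in> X \<times> Y" for j z
    using q(2)[OF that] by (simp add: a_def b_def)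
  \<comment> \<open>The competitor \<open>(x, x)\<close> has value 0 for every penalty
    weight.\<close>
  have le0: "c * (norm (a j - x))\<^sup>2 + real (\<rho> j) * (norm (a j - b j))\<^sup>2 \<le> inner xs (a j - x)" for j
    using min[of "(x, x)" j] \<open>x \<in> X\<close> \<open>x \<in> Y\<close> by (simp add: f_def)
  \<comment> \<open>The penalty term is at most \<open>norm xs * s\<close> while its weight
    \<open>\<rho> j \<ge> j\<close> grows, so both components share their limit. This limit lies in
    \<open>A \<inter> B\<close>, where the normal inequality of \<open>xs\<close> applies.\<close>
  have diag: "fst l = snd l"
  proof -
    have "(norm (a j - b j))\<^sup>2 \<le> norm xs * s * inverse (real j)" if "j > 0" for j
    proof -
      have "real j * (norm (a j - b j))\<^sup>2 \<le> real (\<rho> j) * (norm (a j - b j))\<^sup>2"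
        using seq_suble[OF l(2)] by (intro mult_right_mono) auto
      also have "\<dots> \<le> inner xs (a j - x)"
        using le0[of j] mult_nonneg_nonneg[of c "(norm (a j - x))\<^sup>2"] c
        by (smt (verit) zero_le_power2)
      also have "\<dots> \<le> norm xs * norm (a j - x)" by (rule norm_cauchy_schwarz)
      also have "\<dots> \<le> norm xs * s"
        using ab(1)[of j] by (intro mult_left_mono) (auto simp: X_def dist_norm norm_minus_commute)
      finally show ?thesis using that by (simp add: field_simps)
    qed
    then have "eventually (\<lambda>j. (norm (a j - b j))\<^sup>2 \<le> norm xs * s * inverse (real j)) sequentially"
      by (intro eventually_sequentiallyI[of 1]) auto
    moreover have "(\<lambda>j. (norm (a j - b j))\<^sup>2) \<longlonglongrightarrow> (norm (fst l - snd l))\<^sup>2"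
      by (intro tendsto_intros lim_a lim_b)
    moreover have "(\<lambda>j. norm xs * s * inverse (real j)) \<longlonglongrightarrow> norm xs * s * 0"
      by (intro tendsto_intros lim_inverse_n)
    ultimately have "(norm (fst l - snd l))\<^sup>2 \<le> norm xs * s * 0"
      using tendsto_le trivial_limit_sequentially by blast
    then show ?thesis by simp
  qed
  have near: "norm (fst l - x) < \<eta>"
  proof (rule ccontr)
    assume "\<not> norm (fst l - x) < \<eta>"
    then have ge: "norm (fst l - x) \<ge> \<eta>" by simp
    have "(\<lambda>j. c * (norm (a j - x))\<^sup>2) \<longlonglongrightarrow> c * (norm (fst l - x))\<^sup>2"
      "(\<lambda>j. inner xs (a j - x)) \<longlonglongrightarrow> inner xs (fst l - x)"
      by (intro tendsto_intros lim_a)+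
    moreover have "c * (norm (a j - x))\<^sup>2 \<le> inner xs (a j - x)" for j
      using le0[of j] mult_nonneg_nonneg[of "real (\<rho> j)" "(norm (a j - b j))\<^sup>2"]
      by (smt (verit) zero_le_power2 of_nat_0_le_iff)
    ultimately have "c * (norm (fst l - x))\<^sup>2 \<le> inner xs (fst l - x)"
      by (meson LIMSEQ_le)
    also have "\<dots> \<le> \<epsilon> / 2 * norm (fst l - x)"
      using l(1) diag s by (intro d(2)) (auto simp: X_def Y_def mem_Times_iff dist_norm norm_minus_commute)
    finally have "(c * norm (fst l - x)) * norm (fst l - x) \<le> \<epsilon> / 2 * norm (fst l - x)"
      by (simp add: power2_eq_square mult.assoc)
    moreover have "norm (fst l - x) > 0" using ge \<eta> by linarith
    ultimately have "c * norm (fst l - x) \<le> \<epsilon> / 2" by (simp only: mult_le_cancel_right_pos)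
    moreover have "c * norm (fst l - x) \<ge> \<epsilon>"
      using mult_left_mono[OF ge, of c] c \<eta> by (simp add: c_def)
    ultimately show False using \<epsilon> by linarith
  qed
  have "eventually (\<lambda>j. dist (a j) x < \<eta>) sequentially"
    by (rule order_tendstoD(2)[OF tendsto_dist[OF lim_a tendsto_const]]) (use near in \<open>simp add: dist_norm\<close>)
  moreover have "eventually (\<lambda>j. dist (b j) x < \<eta>) sequentially"
    by (rule order_tendstoD(2)[OF tendsto_dist[OF lim_b tendsto_const]])
      (use near diag in \<open>simp add: dist_norm\<close>)
  ultimately obtain j where j: "dist (a j) x < \<eta>" "dist (b j) x < \<eta>"
    using eventually_happens[OF eventually_conj] trivial_limit_sequentially by blast
  define J where "J = real (\<rho> j)"
  \<comment> \<open>\<open>as\<close> and \<open>bs\<close> are the negative partial gradients of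
    \<open>f (\<rho> j)\<close> at the minimiser. The penalty terms cancel in
    \<open>as + bs\<close>, and only the term with factor \<open>2 * c\<close> separates it from
    \<open>xs\<close>.\<close>
  define as where "as = xs - (2 * c) *\<^sub>R (a j - x) - (2 * J) *\<^sub>R (a j - b j)"
  define bs where "bs = (2 * J) *\<^sub>R (a j - b j)"
  have "as \<in> frechet_normal_cone (a j) A"
  proof (rule frechet_normal_coneI_quadratic)
    \<comment> \<open>Competitors within this radius of \<open>a j\<close> stay in
      \<open>cball x s\<close>, hence in the set over which \<open>f (\<rho> j)\<close> is
      minimised.\<close>
    show "s - dist (a j) x > 0" using j \<eta> by simp
    fix v assume v: "v \<in> A" "norm (v - a j) \<le> s - dist (a j) x"
    then have "v \<in> X"
      using dist_triangle[of v x "a j"] by (simp add: X_def dist_norm norm_minus_commute)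
    then have "f (\<rho> j) (a j, b j) \<le> f (\<rho> j) (v, b j)" using ab by (intro min) auto
    then show "inner as (v - a j) \<le> (c + J) * (norm (v - a j))\<^sup>2"
      unfolding f_def as_def J_def[symmetric] prod.case
        norm_diff_square_shift[of v x "a j"] norm_diff_square_shift[of v "b j" "a j"]
      by (simp add: algebra_simps)
  qed
  moreover have "bs \<in> frechet_normal_cone (b j) B"
  proof (rule frechet_normal_coneI_quadratic)
    show "s - dist (b j) x > 0" using j \<eta> by simp
    fix v assume v: "v \<in> B" "norm (v - b j) \<le> s - dist (b j) x"
    then have "v \<in> Y"
      using dist_triangle[of v x "b j"] by (simp add: Y_def dist_norm norm_minus_commute)
    then have "f (\<rho> j) (a j, b j) \<le> f (\<rho> j) (a j, v)" using ab by (intro min) auto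
    then show "inner bs (v - b j) \<le> J * (norm (v - b j))\<^sup>2"
      unfolding f_def bs_def J_def[symmetric] prod.case
        norm_minus_commute[of "a j" v] norm_minus_commute[of "a j" "b j"]
        norm_diff_square_shift[of v "a j" "b j"]
      by (simp add: algebra_simps)
  qed
  moreover have "norm (xs - (as + bs)) < \<delta>"
  proof -
    have "xs - (as + bs) = (2 * c) *\<^sub>R (a j - x)" by (simp add: as_def bs_def)
    then have "norm (xs - (as + bs)) = 2 * c * dist (a j) x" using c by (simp add: dist_norm)
    also have "\<dots> < 2 * c * \<eta>" using c j by simp
    also have "\<dots> = \<delta>" using \<eta> by (simp add: c_def \<epsilon>_def)
    finally show ?thesis .
  qed
  ultimately show ?thesis
    using ab[of j] j \<eta> by (intro exI[of _ "a j"] exI[of _ "b j"] exI[of _ as] exI[of _ bs])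
      (auto simp: X_def Y_def)
qed

text \<open>The normals supplied by the fuzzy rule may be unbounded; dividing by \<open>1 + \<parallel>as\<parallel>\<close>
  makes them converge along a subsequence, at the price of a multiplier that may vanish.\<close>

lemma fuzzy_intersection_rule_sequences:
  fixes A B :: "'a::euclidean_space set"
  assumes clA: "closed (A \<inter> cball w r)" and clB: "closed (B \<inter> cball w r)"
    and u: "\<And>k. u k \<in> A \<inter> B" "\<And>k. dist (u k) w < r" "u \<longlonglongrightarrow> w"
    and us: "\<And>k. us k \<in> frechet_normal_cone (u k) (A \<inter> B)" "us \<longlonglongrightarrow> xs"
    and \<delta>: "\<And>k::nat. \<delta> k > 0"
  obtains \<rho> a b as bs wa wb \<mu> l where "strict_mono (\<rho> :: nat \<Rightarrow> nat)"
    "tends_in a A w" "\<And>k. dist (a k) (u (\<rho> k)) < \<delta> (\<rho> k)"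
    "\<And>k. as k \<in> frechet_normal_cone (a k) A" "as \<longlonglongrightarrow> wa"
    "tends_in b B w" "\<And>k. dist (b k) (u (\<rho> k)) < \<delta> (\<rho> k)"
    "\<And>k. bs k \<in> frechet_normal_cone (b k) B" "bs \<longlonglongrightarrow> wb"
    "\<And>k. \<mu> k \<ge> 0" "(\<lambda>k. \<mu> k *\<^sub>R us (\<rho> k)) \<longlonglongrightarrow> wa + wb"
    "l \<ge> 0" "wa + wb = l *\<^sub>R xs" "l = 0 \<Longrightarrow> wa \<noteq> 0"
proof -
  \<comment> \<open>The first entry gives the prescribed closeness to \<open>u k\<close>, the second
    makes all errors tend to zero.\<close>
  define \<epsilon> where "\<epsilon> k = min (\<delta> k) (inverse (real (Suc k)))" for k
  have \<epsilon>: "\<epsilon> k > 0" for k using \<delta> by (simp add: \<epsilon>_def)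
  have lim_eps: "e \<longlonglongrightarrow> 0" if "\<And>k. 0 \<le> e k" "\<And>k. e k < \<epsilon> k" for e :: "nat \<Rightarrow> real"
  proof (rule tendsto_sandwich[OF _ _ tendsto_const LIMSEQ_inverse_real_of_nat])
    show "eventually (\<lambda>k. 0 \<le> e k) sequentially" using that by simp
    show "eventually (\<lambda>k. e k \<le> inverse (real (Suc k))) sequentially"
      using that(2) by (intro always_eventually allI) (simp add: \<epsilon>_def less_imp_le)
  qed
  obtain a b as bs where ab:
    "\<And>k. a k \<in> A" "\<And>k. b k \<in> B" "\<And>k. dist (a k) (u k) < \<epsilon> k" "\<And>k. dist (b k) (u k) < \<epsilon> k"
    "\<And>k. as k \<in> frechet_normal_cone (a k) A" "\<And>k. bs k \<in> frechet_normal_cone (b k) B"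
    "\<And>k. norm (us k - (as k + bs k)) < \<epsilon> k"
  proof -
    have "\<exists>a b as bs. a \<in> A \<and> b \<in> B \<and> dist a (u k) < \<epsilon> k \<and> dist b (u k) < \<epsilon> k \<and>
        as \<in> frechet_normal_cone a A \<and> bs \<in> frechet_normal_cone b B \<and>
        norm (us k - (as + bs)) < \<epsilon> k" for k
      by (rule fuzzy_intersection_rule[OF clA clB u(2) u(1) us(1) \<epsilon>])
    then show thesis using that by metis
  qed
  have lim_shift: "v \<longlonglongrightarrow> w" if "\<And>k. dist (v k) (u k) < \<epsilon> k" for v
  proof (rule Lim_transform2[OF u(3)])
    show "(\<lambda>k. u k - v k) \<longlonglongrightarrow> 0"
      using lim_eps[of "\<lambda>k. dist (v k) (u k)"] that
      by (simp add: dist_norm norm_minus_commute tendsto_norm_zero_iff)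
  qed
  have lim_ab: "a \<longlonglongrightarrow> w" "b \<longlonglongrightarrow> w" using lim_shift ab by blast+
  have lim_err: "(\<lambda>k. us k - (as k + bs k)) \<longlonglongrightarrow> 0"
    using lim_eps[of "\<lambda>k. norm (us k - (as k + bs k))"] ab(7) by (simp add: tendsto_norm_zero_iff)
  \<comment> \<open>The scaled normal has norm \<open>1 - \<mu> k\<close>, so the pairs stay in a
    compact set and the limits satisfy \<open>norm wa = 1 - l\<close>. A vanishing multiplier thus
    forces \<open>norm wa = 1\<close>.\<close>
  define \<mu> where "\<mu> k = inverse (1 + norm (as k))" for k
  have \<mu>: "0 \<le> \<mu> k" "\<mu> k \<le> 1" and norm_as: "norm (\<mu> k *\<^sub>R as k) = 1 - \<mu> k" for k
  proof -
    have "1 + norm (as k) > 0" by (simp add: add_pos_nonneg)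
    then show "0 \<le> \<mu> k" "\<mu> k \<le> 1" "norm (\<mu> k *\<^sub>R as k) = 1 - \<mu> k"
      by (simp_all add: \<mu>_def field_simps)
  qed
  have "compact ({0..1::real} \<times> cball (0::'a) 1)"
    by (intro compact_Times compact_Icc compact_cball)
  moreover have "\<forall>k. (\<mu> k, \<mu> k *\<^sub>R as k) \<in> {0..1::real} \<times> cball (0::'a) 1"
    using \<mu> norm_as by simp
  ultimately obtain p \<rho> where p: "p \<in> {0..1::real} \<times> cball (0::'a) 1"
    and \<rho>: "strict_mono \<rho>" and lim_p: "((\<lambda>k. (\<mu> k, \<mu> k *\<^sub>R as k)) \<circ> \<rho>) \<longlonglongrightarrow> p"
    unfolding compact_def by (elim allE[of _ "\<lambda>k. (\<mu> k, \<mu> k *\<^sub>R as k)"]) blast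
  define l where "l = fst p"
  define wa where "wa = snd p"
  have lim_\<mu>: "(\<lambda>k. \<mu> (\<rho> k)) \<longlonglongrightarrow> l" and lim_as: "(\<lambda>k. \<mu> (\<rho> k) *\<^sub>R as (\<rho> k)) \<longlonglongrightarrow> wa"
    using tendsto_fst[OF lim_p] tendsto_snd[OF lim_p] by (simp_all add: l_def wa_def o_def)
  have sub: "(\<lambda>k. v (\<rho> k)) \<longlonglongrightarrow> q" if "v \<longlonglongrightarrow> q" for v and q :: 'a
    using LIMSEQ_subseq_LIMSEQ[OF that \<rho>] by (simp add: o_def)
  have lim_us: "(\<lambda>k. \<mu> (\<rho> k) *\<^sub>R us (\<rho> k)) \<longlonglongrightarrow> l *\<^sub>R xs"
    by (intro tendsto_intros lim_\<mu> sub us)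
  \<comment> \<open>Scaled form of \<open>bs = us - as - (us - (as + bs))\<close>: every term on the
    right converges, hence so does the scaled \<open>bs\<close>.\<close>
  have "(\<lambda>k. \<mu> (\<rho> k) *\<^sub>R us (\<rho> k) - \<mu> (\<rho> k) *\<^sub>R as (\<rho> k)
      - \<mu> (\<rho> k) *\<^sub>R (us (\<rho> k) - (as (\<rho> k) + bs (\<rho> k)))) \<longlonglongrightarrow> l *\<^sub>R xs - wa - l *\<^sub>R 0"
    by (intro tendsto_diff lim_us lim_as tendsto_scaleR lim_\<mu> sub[OF lim_err])
  then have lim_bs: "(\<lambda>k. \<mu> (\<rho> k) *\<^sub>R bs (\<rho> k)) \<longlonglongrightarrow> l *\<^sub>R xs - wa"
    by (simp add: algebra_simps)
  have "(\<lambda>k. norm (\<mu> (\<rho> k) *\<^sub>R as (\<rho> k))) \<longlonglongrightarrow> 1 - l"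
    unfolding norm_as by (intro tendsto_intros lim_\<mu>)
  then have "norm wa = 1 - l"
    using LIMSEQ_unique tendsto_norm[OF lim_as] by blast
  then have "l = 0 \<Longrightarrow> wa \<noteq> 0" by auto
  show thesis
  proof (rule that[of \<rho> "\<lambda>k. a (\<rho> k)" "\<lambda>k. \<mu> (\<rho> k) *\<^sub>R as (\<rho> k)" wa
        "\<lambda>k. b (\<rho> k)" "\<lambda>k. \<mu> (\<rho> k) *\<^sub>R bs (\<rho> k)" "l *\<^sub>R xs - wa" "\<lambda>k. \<mu> (\<rho> k)" l])
    show "tends_in (\<lambda>k. a (\<rho> k)) A w" "tends_in (\<lambda>k. b (\<rho> k)) B w"
      using ab lim_ab sub by (auto simp: tends_in_def)
    show "dist (a (\<rho> k)) (u (\<rho> k)) < \<delta> (\<rho> k)" "dist (b (\<rho> k)) (u (\<rho> k)) < \<delta> (\<rho> k)" for k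
      using ab(3,4)[of "\<rho> k"] by (simp_all add: \<epsilon>_def)
    show "l \<ge> 0" using p by (auto simp: l_def)
  qed (use \<rho> \<mu> ab lim_as lim_bs lim_us \<open>l = 0 \<Longrightarrow> wa \<noteq> 0\<close> in
      \<open>auto intro: frechet_normal_cone_scaleR\<close>)
qed

section \<open>Intersection rule for limiting normal cones with respect to sets\<close>

text \<open>A rule of Fritz John type: only a multiple of \<open>xs\<close> is split, and it may be
  the zero multiple. The nontriviality clause for \<open>l = 0\<close> lets a qualification
  condition exclude that case later.\<close>

lemma limiting_normal_cone_wrt_intersection:
  fixes \<Omega>\<^sub>1 \<Omega>\<^sub>2 D\<^sub>1 D\<^sub>2 :: "'a::euclidean_space set"
  assumes cl: "closed (\<Omega>\<^sub>1 \<inter> D\<^sub>1 \<inter> cball w r)" "closed (\<Omega>\<^sub>2 \<inter> D\<^sub>2 \<inter> cball w r)" and r: "r > 0"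
    and nd: "normal_densed \<Omega>\<^sub>1 \<Omega>\<^sub>2 D\<^sub>1 D\<^sub>2 w"
    and xs: "xs \<in> limiting_normal_cone_wrt (D\<^sub>1 \<inter> D\<^sub>2) w (\<Omega>\<^sub>1 \<inter> \<Omega>\<^sub>2)"
  obtains l v\<^sub>1 v\<^sub>2 where "l \<ge> 0" "v\<^sub>1 \<in> limiting_normal_cone_wrt D\<^sub>1 w \<Omega>\<^sub>1"
    "v\<^sub>2 \<in> limiting_normal_cone_wrt D\<^sub>2 w \<Omega>\<^sub>2" "v\<^sub>1 + v\<^sub>2 = l *\<^sub>R xs" "l = 0 \<Longrightarrow> v\<^sub>1 \<noteq> 0 \<or> v\<^sub>2 \<noteq> 0"
proof -
  let ?D = "D\<^sub>1 \<inter> D\<^sub>2"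
  obtain u0 us0 where u0: "tends_in u0 (\<Omega>\<^sub>1 \<inter> \<Omega>\<^sub>2 \<inter> ?D) w" "us0 \<longlonglongrightarrow> xs"
    "\<And>k. us0 k \<in> frechet_normal_cone_wrt ?D (u0 k) (\<Omega>\<^sub>1 \<inter> \<Omega>\<^sub>2)"
    using xs unfolding limiting_normal_cone_wrt_def by blast
  \<comment> \<open>The fuzzy rule needs base points inside the ball on which closedness is
    known.\<close>
  have ev: "eventually (\<lambda>k. dist (u0 k) w < r) sequentially"
    using u0(1) r unfolding tends_in_def by (blast intro: tendstoD)
  \<comment> \<open>A subsequence is chosen on which either all or none of the base points are
    interior to \<open>?D\<close>: an infinite set of indices is enumerated in the first case, a
    tail is taken in the second.\<close>
  have "\<exists>\<sigma> :: nat \<Rightarrow> nat. strict_mono \<sigma> \<and> (\<forall>k. dist (u0 (\<sigma> k)) w < r) \<and>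
      ((\<forall>k. u0 (\<sigma> k) \<in> interior ?D) \<or> (\<forall>k. u0 (\<sigma> k) \<notin> interior ?D))"
  proof (cases "frequently (\<lambda>k. u0 k \<in> interior ?D) sequentially")
    case True
    then have "infinite {k. u0 k \<in> interior ?D \<and> dist (u0 k) w < r}"
      using frequently_eventually_frequently[OF True ev] unfolding cofinite_eq_sequentially[symmetric]
      by (simp add: frequently_cofinite)
    from infinite_enumerate[OF this] show ?thesis
      unfolding mem_Collect_eq by blast
  next
    case False
    then have "eventually (\<lambda>k. u0 k \<notin> interior ?D \<and> dist (u0 k) w < r) sequentially"
      using ev by (simp add: not_frequently eventually_conj_iff)
    then obtain N where "\<And>k. k \<ge> N \<Longrightarrow> u0 k \<notin> interior ?D \<and> dist (u0 k) w < r"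
      unfolding eventually_sequentially by blast
    then show ?thesis by (intro exI[of _ "\<lambda>k. k + N"]) (auto simp: strict_mono_def)
  qed
  then obtain \<sigma> :: "nat \<Rightarrow> nat" where \<sigma>: "strict_mono \<sigma>" "\<And>k. dist (u0 (\<sigma> k)) w < r"
    and cases: "(\<forall>k. u0 (\<sigma> k) \<in> interior ?D) \<or> (\<forall>k. u0 (\<sigma> k) \<notin> interior ?D)"
    by blast
  define u where "u = u0 \<circ> \<sigma>"
  define us where "us = us0 \<circ> \<sigma>"
  have u: "u k \<in> (\<Omega>\<^sub>1 \<inter> D\<^sub>1) \<inter> (\<Omega>\<^sub>2 \<inter> D\<^sub>2)" "dist (u k) w < r"
    "us k \<in> frechet_normal_cone (u k) ((\<Omega>\<^sub>1 \<inter> D\<^sub>1) \<inter> (\<Omega>\<^sub>2 \<inter> D\<^sub>2))"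
    "us k \<in> radial_directions (u k) ?D" for k
  proof -
    have "\<Omega>\<^sub>1 \<inter> \<Omega>\<^sub>2 \<inter> ?D = (\<Omega>\<^sub>1 \<inter> D\<^sub>1) \<inter> (\<Omega>\<^sub>2 \<inter> D\<^sub>2)" by blast
    with u0 \<sigma> show "u k \<in> (\<Omega>\<^sub>1 \<inter> D\<^sub>1) \<inter> (\<Omega>\<^sub>2 \<inter> D\<^sub>2)" "dist (u k) w < r"
      "us k \<in> frechet_normal_cone (u k) ((\<Omega>\<^sub>1 \<inter> D\<^sub>1) \<inter> (\<Omega>\<^sub>2 \<inter> D\<^sub>2))"
      "us k \<in> radial_directions (u k) ?D"
      by (auto simp: u_def us_def tends_in_def frechet_normal_cone_wrt_def)
  qed
  have lim: "u \<longlonglongrightarrow> w" "us \<longlonglongrightarrow> xs"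
    using u0 LIMSEQ_subseq_LIMSEQ[OF _ \<sigma>(1)] by (auto simp: u_def us_def tends_in_def)
  \<comment> \<open>At interior points this closeness keeps the base points of the split normals in
    \<open>interior ?D\<close>; elsewhere 1 is a default.\<close>
  have "\<exists>d>0. u k \<in> interior ?D \<longrightarrow> ball (u k) d \<subseteq> interior ?D" for k
    using open_contains_ball[of "interior ?D"] by (cases "u k \<in> interior ?D") (auto intro: exI[of _ 1])
  then obtain \<delta> where \<delta>: "\<And>k. \<delta> k > 0" "\<And>k. u k \<in> interior ?D \<Longrightarrow> ball (u k) (\<delta> k) \<subseteq> interior ?D"
    by metis
  obtain \<rho> a b as bs wa wb \<mu> l where \<rho>: "strict_mono (\<rho> :: nat \<Rightarrow> nat)"
    and a: "tends_in a (\<Omega>\<^sub>1 \<inter> D\<^sub>1) w" "\<And>k. dist (a k) (u (\<rho> k)) < \<delta> (\<rho> k)"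
      "\<And>k. as k \<in> frechet_normal_cone (a k) (\<Omega>\<^sub>1 \<inter> D\<^sub>1)" "as \<longlonglongrightarrow> wa"
    and b: "tends_in b (\<Omega>\<^sub>2 \<inter> D\<^sub>2) w" "\<And>k. dist (b k) (u (\<rho> k)) < \<delta> (\<rho> k)"
      "\<And>k. bs k \<in> frechet_normal_cone (b k) (\<Omega>\<^sub>2 \<inter> D\<^sub>2)" "bs \<longlonglongrightarrow> wb"
    and \<mu>: "\<And>k. \<mu> k \<ge> 0" "(\<lambda>k. \<mu> k *\<^sub>R us (\<rho> k)) \<longlonglongrightarrow> wa + wb"
    and l: "l \<ge> 0" "wa + wb = l *\<^sub>R xs" "l = 0 \<Longrightarrow> wa \<noteq> 0"
    by (rule fuzzy_intersection_rule_sequences[where \<delta> = \<delta>, OF cl u(1,2) lim(1) u(3) lim(2) \<delta>(1)])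
      blast
  show thesis
  proof (cases "\<forall>k. u k \<in> interior ?D")
    case True
    have "a k \<in> ball (u (\<rho> k)) (\<delta> (\<rho> k))" "b k \<in> ball (u (\<rho> k)) (\<delta> (\<rho> k))" for k
      using a(2) b(2) by (simp_all add: dist_commute)
    with True \<delta>(2) have "a k \<in> interior D\<^sub>1" "b k \<in> interior D\<^sub>2" for k
      by (simp_all add: subset_iff) blast+
    then have "as k \<in> frechet_normal_cone_wrt D\<^sub>1 (a k) \<Omega>\<^sub>1" "bs k \<in> frechet_normal_cone_wrt D\<^sub>2 (b k) \<Omega>\<^sub>2" for k
      using a(3) b(3) by (simp_all add: frechet_normal_cone_wrt_def radial_directions_interior)
    then have "wa \<in> limiting_normal_cone_wrt D\<^sub>1 w \<Omega>\<^sub>1" "wb \<in> limiting_normal_cone_wrt D\<^sub>2 w \<Omega>\<^sub>2"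
      using a b unfolding limiting_normal_cone_wrt_def by blast+
    with l show thesis by (intro that) auto
  next
    case False
    \<comment> \<open>The second alternative of \<open>cases\<close> must hold, so each
      \<open>u k\<close> lies in \<open>?D\<close> but not in its interior.\<close>
    with cases have "u k \<in> frontier ?D" for k
      using u(1)[of k] closure_subset[of ?D] by (auto simp: u_def frontier_def)
    with u(1) LIMSEQ_subseq_LIMSEQ[OF lim(1) \<rho>]
    have fr: "tends_in (u \<circ> \<rho>) ((\<Omega>\<^sub>1 \<inter> \<Omega>\<^sub>2) \<inter> frontier ?D) w" by (simp add: tends_in_def)
    \<comment> \<open>The scaled \<open>us\<close> converge to \<open>wa + wb\<close> and stay
      radial under nonnegative factors. They are the third dual sequence that
      \<open>normal_densed\<close> asks for.\<close>
    have rad: "\<mu> k *\<^sub>R us (\<rho> k) \<in> radial_directions ((u \<circ> \<rho>) k) ?D" for k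
      using u(1,4)[of "\<rho> k"] \<mu>(1) by (auto intro: radial_directions_scaleR)
    obtain t\<^sub>1 t\<^sub>2 ts\<^sub>1 ts\<^sub>2 v\<^sub>1 v\<^sub>2 where t:
      "tends_in t\<^sub>1 (\<Omega>\<^sub>1 \<inter> D\<^sub>1) w" "tends_in t\<^sub>2 (\<Omega>\<^sub>2 \<inter> D\<^sub>2) w"
      "\<forall>k. ts\<^sub>1 k \<in> frechet_normal_cone_wrt D\<^sub>1 (t\<^sub>1 k) \<Omega>\<^sub>1"
      "\<forall>k. ts\<^sub>2 k \<in> frechet_normal_cone_wrt D\<^sub>2 (t\<^sub>2 k) \<Omega>\<^sub>2"
      "ts\<^sub>1 \<longlonglongrightarrow> v\<^sub>1" "ts\<^sub>2 \<longlonglongrightarrow> v\<^sub>2" "v\<^sub>1 + v\<^sub>2 = wa + wb"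
      "max (norm wa) (norm wb) > 0 \<longrightarrow> max (norm v\<^sub>1) (norm v\<^sub>2) > 0"
      using nd[unfolded normal_densed_def, rule_format, of a b "u \<circ> \<rho>" as bs "\<lambda>k. \<mu> k *\<^sub>R us (\<rho> k)" wa wb]
        a b fr rad \<mu>(2) by blast
    show thesis
    proof (rule that[OF l(1)])
      show "v\<^sub>1 \<in> limiting_normal_cone_wrt D\<^sub>1 w \<Omega>\<^sub>1" "v\<^sub>2 \<in> limiting_normal_cone_wrt D\<^sub>2 w \<Omega>\<^sub>2"
        using t unfolding limiting_normal_cone_wrt_def by blast+
      show "v\<^sub>1 + v\<^sub>2 = l *\<^sub>R xs" using t(7) l(2) by simp
      \<comment> \<open>Here \<open>wa \<noteq> 0\<close>, and the last clause of
        \<open>normal_densed\<close> carries nontriviality over to the replaced normals.\<close>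
      show "v\<^sub>1 \<noteq> 0 \<or> v\<^sub>2 \<noteq> 0" if "l = 0"
        using t(8) l(3)[OF that] by (auto simp: less_max_iff_disj)
    qed
  qed
qed

section \<open>Lifted graphs: their normals, coderivatives and closedness\<close>

text \<open>The lift leaves \<open>y\<^sub>2\<close> free, so its slice in that coordinate is a
  whole space, whose only normal is 0. Freezing \<open>y\<^sub>2\<close> embeds the restricted graph
  in the lift and transfers the other two components.\<close>

lemma frechet_normal_cone_wrt_graph_lift1:
  fixes F :: "('a::euclidean_space, 'b::euclidean_space) multifun"
  assumes n: "(a, b, c) \<in> frechet_normal_cone_wrt (C \<times> UNIV) (x, y\<^sub>1, y\<^sub>2) (graph_lift1 F)"
    and x: "x \<in> C" "y\<^sub>1 \<in> F x"
  shows "c = 0" "(a, b) \<in> frechet_normal_cone_wrt (C \<times> UNIV) (x, y\<^sub>1) (gph (mrestrict F C))"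
proof -
  have f: "(a, b, c) \<in> frechet_normal_cone (x, y\<^sub>1, y\<^sub>2) (graph_lift1 F \<inter> C \<times> UNIV)"
    using n by (simp add: frechet_normal_cone_wrt_def)
  have "c \<in> frechet_normal_cone y\<^sub>2 UNIV"
    by (rule frechet_normal_cone_transfer[where g = "\<lambda>z. (x, y\<^sub>1, z)" and K = 1, OF f])
      (use x in \<open>auto simp: graph_lift1_def gph_def norm_Pair\<close>)
  then show "c = 0" by (simp add: frechet_normal_cone_UNIV)
  have "(a, b) \<in> frechet_normal_cone (x, y\<^sub>1) (gph (mrestrict F C) \<inter> C \<times> UNIV)"
    by (rule frechet_normal_cone_transfer
        [where g = "\<lambda>z. (fst z, snd z, y\<^sub>2)" and x = "(x, y\<^sub>1)" and xs = "(a, b, c)" and K = 1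
          and \<Omega> = "graph_lift1 F \<inter> C \<times> UNIV"])
      (use f in \<open>auto simp: graph_lift1_def gph_def mrestrict_def norm_Pair\<close>)
  \<comment> \<open>The radial condition concerns only the first component, so it is the same for
    both products.\<close>
  with n show "(a, b) \<in> frechet_normal_cone_wrt (C \<times> UNIV) (x, y\<^sub>1) (gph (mrestrict F C))"
    by (simp add: frechet_normal_cone_wrt_def radial_directions_def)
qed

text \<open>The mirror image, with \<open>y\<^sub>1\<close> free; the letters are ordered so that
  \<open>c\<close> again belongs to the free coordinate.\<close>

lemma frechet_normal_cone_wrt_graph_lift2:
  fixes F :: "('a::euclidean_space, 'b::euclidean_space) multifun"
  assumes n: "(a, c, b) \<in> frechet_normal_cone_wrt (C \<times> UNIV) (x, y\<^sub>1, y\<^sub>2) (graph_lift2 F)"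
    and x: "x \<in> C" "y\<^sub>2 \<in> F x"
  shows "c = 0" "(a, b) \<in> frechet_normal_cone_wrt (C \<times> UNIV) (x, y\<^sub>2) (gph (mrestrict F C))"
proof -
  have f: "(a, c, b) \<in> frechet_normal_cone (x, y\<^sub>1, y\<^sub>2) (graph_lift2 F \<inter> C \<times> UNIV)"
    using n by (simp add: frechet_normal_cone_wrt_def)
  have "c \<in> frechet_normal_cone y\<^sub>1 UNIV"
    by (rule frechet_normal_cone_transfer[where g = "\<lambda>z. (x, z, y\<^sub>2)" and K = 1, OF f])
      (use x in \<open>auto simp: graph_lift2_def gph_def norm_Pair\<close>)
  then show "c = 0" by (simp add: frechet_normal_cone_UNIV)
  have "(a, b) \<in> frechet_normal_cone (x, y\<^sub>2) (gph (mrestrict F C) \<inter> C \<times> UNIV)"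
    by (rule frechet_normal_cone_transfer
        [where g = "\<lambda>z. (fst z, y\<^sub>1, snd z)" and x = "(x, y\<^sub>2)" and xs = "(a, c, b)" and K = 1
          and \<Omega> = "graph_lift2 F \<inter> C \<times> UNIV"])
      (use f in \<open>auto simp: graph_lift2_def gph_def mrestrict_def norm_Pair\<close>)
  with n show "(a, b) \<in> frechet_normal_cone_wrt (C \<times> UNIV) (x, y\<^sub>2) (gph (mrestrict F C))"
    by (simp add: frechet_normal_cone_wrt_def radial_directions_def)
qed

text \<open>Both facts hold along the approximating sequence and survive the limit. The argument
  \<open>- b\<close> offsets the sign in \<open>coderivative_wrt\<close>.\<close>

lemma limiting_normal_cone_wrt_graph_lift1:
  fixes F :: "('a::euclidean_space, 'b::euclidean_space) multifun"
  assumes "(a, b, c) \<in> limiting_normal_cone_wrt (C \<times> UNIV) (x, y\<^sub>1, y\<^sub>2) (graph_lift1 F)"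
  shows "c = 0" "a \<in> coderivative_wrt C F x y\<^sub>1 (- b)"
proof -
  obtain u us where u: "tends_in u (graph_lift1 F \<inter> C \<times> UNIV) (x, y\<^sub>1, y\<^sub>2)" "us \<longlonglongrightarrow> (a, b, c)"
    "\<And>k. us k \<in> frechet_normal_cone_wrt (C \<times> UNIV) (u k) (graph_lift1 F)"
    using assms unfolding limiting_normal_cone_wrt_def by blast
  have lim_u: "u \<longlonglongrightarrow> (x, y\<^sub>1, y\<^sub>2)" using u(1) by (simp add: tends_in_def)
  have uC: "fst (u k) \<in> C" "fst (snd (u k)) \<in> F (fst (u k))" for k
    using u(1) by (auto simp: tends_in_def graph_lift1_def gph_def dest!: spec[of _ k])
  have n: "snd (snd (us k)) = 0"
    "(fst (us k), fst (snd (us k))) \<in>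
      frechet_normal_cone_wrt (C \<times> UNIV) (fst (u k), fst (snd (u k))) (gph (mrestrict F C))" for k
    using frechet_normal_cone_wrt_graph_lift1[of "fst (us k)" "fst (snd (us k))" "snd (snd (us k))" C
        "fst (u k)" "fst (snd (u k))" "snd (snd (u k))" F] u(3)[of k] uC[of k] unfolding prod.collapse by blast+
  have "(\<lambda>k. snd (snd (us k))) \<longlonglongrightarrow> c"
    using tendsto_snd[OF tendsto_snd[OF u(2)]] by simp
  then show "c = 0" unfolding n by (simp add: LIMSEQ_const_iff)
  have lim': "(\<lambda>k. (fst (us k), fst (snd (us k)))) \<longlonglongrightarrow> (a, b)"
    using tendsto_Pair[OF tendsto_fst[OF u(2)] tendsto_fst[OF tendsto_snd[OF u(2)]]] by simp
  have tn: "tends_in (\<lambda>k. (fst (u k), fst (snd (u k)))) (gph (mrestrict F C) \<inter> C \<times> UNIV) (x, y\<^sub>1)"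
    using tendsto_Pair[OF tendsto_fst[OF lim_u] tendsto_fst[OF tendsto_snd[OF lim_u]]] uC
    by (simp add: tends_in_def gph_def mrestrict_def)
  have "(a, b) \<in> limiting_normal_cone_wrt (C \<times> UNIV) (x, y\<^sub>1) (gph (mrestrict F C))"
    by (rule limiting_normal_cone_wrtI[OF tn n(2) lim'])
  then show "a \<in> coderivative_wrt C F x y\<^sub>1 (- b)"
    by (simp add: coderivative_wrt_def)
qed

lemma limiting_normal_cone_wrt_graph_lift2:
  fixes F :: "('a::euclidean_space, 'b::euclidean_space) multifun"
  assumes "(a, c, b) \<in> limiting_normal_cone_wrt (C \<times> UNIV) (x, y\<^sub>1, y\<^sub>2) (graph_lift2 F)"
  shows "c = 0" "a \<in> coderivative_wrt C F x y\<^sub>2 (- b)"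
proof -
  obtain u us where u: "tends_in u (graph_lift2 F \<inter> C \<times> UNIV) (x, y\<^sub>1, y\<^sub>2)" "us \<longlonglongrightarrow> (a, c, b)"
    "\<And>k. us k \<in> frechet_normal_cone_wrt (C \<times> UNIV) (u k) (graph_lift2 F)"
    using assms unfolding limiting_normal_cone_wrt_def by blast
  have lim_u: "u \<longlonglongrightarrow> (x, y\<^sub>1, y\<^sub>2)" using u(1) by (simp add: tends_in_def)
  have uC: "fst (u k) \<in> C" "snd (snd (u k)) \<in> F (fst (u k))" for k
    using u(1) by (auto simp: tends_in_def graph_lift2_def gph_def dest!: spec[of _ k])
  have n: "fst (snd (us k)) = 0"
    "(fst (us k), snd (snd (us k))) \<in>
      frechet_normal_cone_wrt (C \<times> UNIV) (fst (u k), snd (snd (u k))) (gph (mrestrict F C))" for k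
    using frechet_normal_cone_wrt_graph_lift2[of "fst (us k)" "fst (snd (us k))" "snd (snd (us k))" C
        "fst (u k)" "fst (snd (u k))" "snd (snd (u k))" F] u(3)[of k] uC[of k] unfolding prod.collapse by blast+
  have "(\<lambda>k. fst (snd (us k))) \<longlonglongrightarrow> c"
    using tendsto_fst[OF tendsto_snd[OF u(2)]] by simp
  then show "c = 0" unfolding n by (simp add: LIMSEQ_const_iff)
  have lim': "(\<lambda>k. (fst (us k), snd (snd (us k)))) \<longlonglongrightarrow> (a, b)"
    using tendsto_Pair[OF tendsto_fst[OF u(2)] tendsto_snd[OF tendsto_snd[OF u(2)]]] by simp
  have tn: "tends_in (\<lambda>k. (fst (u k), snd (snd (u k)))) (gph (mrestrict F C) \<inter> C \<times> UNIV) (x, y\<^sub>2)"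
    using tendsto_Pair[OF tendsto_fst[OF lim_u] tendsto_snd[OF tendsto_snd[OF lim_u]]] uC
    by (simp add: tends_in_def gph_def mrestrict_def)
  have "(a, b) \<in> limiting_normal_cone_wrt (C \<times> UNIV) (x, y\<^sub>2) (gph (mrestrict F C))"
    by (rule limiting_normal_cone_wrtI[OF tn n(2) lim'])
  then show "a \<in> coderivative_wrt C F x y\<^sub>2 (- b)"
    by (simp add: coderivative_wrt_def)
qed

text \<open>Inherited from the limiting cone, with both arguments scaled at once; it allows division
  by the multiplier.\<close>

lemma coderivative_wrt_scaleR:
  assumes "xs \<in> coderivative_wrt C F x y ys" "c \<ge> 0"
  shows "c *\<^sub>R xs \<in> coderivative_wrt C F x y (c *\<^sub>R ys)"
  using limiting_normal_cone_wrt_scaleR[of "(xs, - ys)" _ _ _ c] assms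
  by (simp add: coderivative_wrt_def)

text \<open>The projection forgetting \<open>y\<^sub>2\<close> is continuous and does not increase
  distances, so the set is a closed preimage cut by closed sets.\<close>

lemma closed_graph_lift1:
  fixes F :: "('a::euclidean_space, 'b::euclidean_space) multifun"
  assumes cl: "closed (gph F \<inter> cball (x, y\<^sub>1) r)" and C: "closed C"
  shows "closed (graph_lift1 F \<inter> C \<times> UNIV \<inter> cball (x, y\<^sub>1, y\<^sub>2) r)"
proof -
  let ?P = "\<lambda>z :: 'a \<times> 'b \<times> 'b. (fst z, fst (snd z))"
  have "?P z \<in> cball (x, y\<^sub>1) r" if "z \<in> cball (x, y\<^sub>1, y\<^sub>2) r" for z
  proof -
    have "dist (?P z) (x, y\<^sub>1) \<le> dist z (x, y\<^sub>1, y\<^sub>2)"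
      by (auto simp: dist_prod_def intro!: real_sqrt_le_mono)
    with that show ?thesis by (simp add: dist_commute)
  qed
  moreover have "z \<in> graph_lift1 F \<longleftrightarrow> ?P z \<in> gph F" for z
    by (cases z) (simp add: graph_lift1_def)
  ultimately have "graph_lift1 F \<inter> C \<times> UNIV \<inter> cball (x, y\<^sub>1, y\<^sub>2) r =
      ?P -` (gph F \<inter> cball (x, y\<^sub>1) r) \<inter> C \<times> UNIV \<inter> cball (x, y\<^sub>1, y\<^sub>2) r"
    by blast
  also have "closed \<dots>"
    by (intro closed_Int closed_vimage[OF cl] closed_Times C closed_cball closed_UNIV continuous_intros)
  finally show ?thesis .
qed

lemma closed_graph_lift2:
  fixes F :: "('a::euclidean_space, 'b::euclidean_space) multifun"
  assumes cl: "closed (gph F \<inter> cball (x, y\<^sub>2) r)" and C: "closed C"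
  shows "closed (graph_lift2 F \<inter> C \<times> UNIV \<inter> cball (x, y\<^sub>1, y\<^sub>2) r)"
proof -
  let ?P = "\<lambda>z :: 'a \<times> 'b \<times> 'b. (fst z, snd (snd z))"
  have "?P z \<in> cball (x, y\<^sub>2) r" if "z \<in> cball (x, y\<^sub>1, y\<^sub>2) r" for z
  proof -
    have "dist (?P z) (x, y\<^sub>2) \<le> dist z (x, y\<^sub>1, y\<^sub>2)"
      by (auto simp: dist_prod_def intro!: real_sqrt_le_mono)
    with that show ?thesis by (simp add: dist_commute)
  qed
  moreover have "z \<in> graph_lift2 F \<longleftrightarrow> ?P z \<in> gph F" for z
    by (cases z) (simp add: graph_lift2_def)
  ultimately have "graph_lift2 F \<inter> C \<times> UNIV \<inter> cball (x, y\<^sub>1, y\<^sub>2) r =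
      ?P -` (gph F \<inter> cball (x, y\<^sub>2) r) \<inter> C \<times> UNIV \<inter> cball (x, y\<^sub>1, y\<^sub>2) r"
    by blast
  also have "closed \<dots>"
    by (intro closed_Int closed_vimage[OF cl] closed_Times C closed_cball closed_UNIV continuous_intros)
  finally show ?thesis .
qed

section \<open>The coderivative sum rule\<close>

text \<open>The adjoint of the sum map duplicates the second dual component, and the map sends the
  lifts over \<open>C\<close> into the restricted graph of the sum.\<close>

lemma frechet_normal_cone_wrt_sum_splitting:
  fixes F\<^sub>1 F\<^sub>2 :: "('a::euclidean_space, 'b::euclidean_space) multifun"
  assumes n: "(xs, - ys) \<in> frechet_normal_cone_wrt (C \<times> UNIV) (x, y\<^sub>1 + y\<^sub>2) (gph (mrestrict (msum F\<^sub>1 F\<^sub>2) C))"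
  shows "(xs, - ys, - ys) \<in>
    frechet_normal_cone_wrt (C \<times> UNIV) (x, y\<^sub>1, y\<^sub>2) (graph_lift1 F\<^sub>1 \<inter> graph_lift2 F\<^sub>2)"
proof -
  let ?G = "gph (mrestrict (msum F\<^sub>1 F\<^sub>2) C) \<inter> C \<times> UNIV"
  let ?g = "\<lambda>z :: 'a \<times> 'b \<times> 'b. (fst z, fst (snd z) + snd (snd z))"
  have "(xs, - ys, - ys) \<in> frechet_normal_cone (x, y\<^sub>1, y\<^sub>2)
      (graph_lift1 F\<^sub>1 \<inter> graph_lift2 F\<^sub>2 \<inter> C \<times> UNIV)"
  proof (rule frechet_normal_cone_transfer[where g = ?g and K = 3 and xs = "(xs, - ys)" and \<Omega> = ?G])
    show "(xs, - ys) \<in> frechet_normal_cone (?g (x, y\<^sub>1, y\<^sub>2)) ?G"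
      using n by (simp add: frechet_normal_cone_wrt_def)
    show "?g z \<in> ?G" if "z \<in> graph_lift1 F\<^sub>1 \<inter> graph_lift2 F\<^sub>2 \<inter> C \<times> UNIV" for z
      using that
      by (auto simp: graph_lift1_def graph_lift2_def gph_def mrestrict_def msum_def intro: set_plus_intro)
    show "norm (?g z - ?g (x, y\<^sub>1, y\<^sub>2)) \<le> 3 * norm (z - (x, y\<^sub>1, y\<^sub>2))" for z
    proof -
      obtain p q s where z: "z - (x, y\<^sub>1, y\<^sub>2) = (p, q, s)" by (metis prod_cases3)
      then have "?g z - ?g (x, y\<^sub>1, y\<^sub>2) = (p, q + s)" by (cases z) auto
      also have "norm \<dots> \<le> norm p + norm q + norm s"
        using norm_Pair_le[of p "q + s"] norm_triangle_ineq[of q s] by linarith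
      also have "\<dots> \<le> 3 * norm (z - (x, y\<^sub>1, y\<^sub>2))"
        using sum_norm3_bounds(2)[of "(p, q, s)"] by (simp add: z)
      finally show ?thesis .
    qed
    show "inner (xs, - ys) (?g z - ?g (x, y\<^sub>1, y\<^sub>2)) = inner (xs, - ys, - ys) (z - (x, y\<^sub>1, y\<^sub>2))" for z
      by (cases z) (simp add: algebra_simps)
  qed
  with n show ?thesis by (simp add: frechet_normal_cone_wrt_def radial_directions_def)
qed

text \<open>The intersection rule splits a multiple of the normal; \<open>q1\<close> makes the
  multiplier positive, and homogeneity divides it out.\<close>

lemma coderivative_msum_decomposition:
  fixes F\<^sub>1 F\<^sub>2 :: "('a::euclidean_space, 'b::euclidean_space) multifun"
  assumes C: "closed C\<^sub>1" "closed C\<^sub>2"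
    and q1: "coderivative_qualification C\<^sub>1 C\<^sub>2 F\<^sub>1 F\<^sub>2 x y\<^sub>1 y\<^sub>2"
    and q2: "normal_densed_qualification C\<^sub>1 C\<^sub>2 F\<^sub>1 F\<^sub>2 x y\<^sub>1 y\<^sub>2"
    and lc: "locally_closed_around (gph F\<^sub>1) (x, y\<^sub>1)" "locally_closed_around (gph F\<^sub>2) (x, y\<^sub>2)"
    and xs: "(xs, - ys, - ys) \<in> limiting_normal_cone_wrt ((C\<^sub>1 \<inter> C\<^sub>2) \<times> UNIV) (x, y\<^sub>1, y\<^sub>2)
      (graph_lift1 F\<^sub>1 \<inter> graph_lift2 F\<^sub>2)"
  shows "xs \<in> coderivative_wrt C\<^sub>1 F\<^sub>1 x y\<^sub>1 ys + coderivative_wrt C\<^sub>2 F\<^sub>2 x y\<^sub>2 ys"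
proof -
  obtain r1 r2 where r: "r1 > 0" "\<And>s. 0 < s \<Longrightarrow> s \<le> r1 \<Longrightarrow> closed (gph F\<^sub>1 \<inter> cball (x, y\<^sub>1) s)"
    "r2 > 0" "\<And>s. 0 < s \<Longrightarrow> s \<le> r2 \<Longrightarrow> closed (gph F\<^sub>2 \<inter> cball (x, y\<^sub>2) s)"
    using lc unfolding locally_closed_around_def by metis
  define r where "r = min r1 r2"
  have cl: "closed (graph_lift1 F\<^sub>1 \<inter> C\<^sub>1 \<times> UNIV \<inter> cball (x, y\<^sub>1, y\<^sub>2) r)"
    "closed (graph_lift2 F\<^sub>2 \<inter> C\<^sub>2 \<times> UNIV \<inter> cball (x, y\<^sub>1, y\<^sub>2) r)" "r > 0"
    using r C by (auto simp: r_def intro!: closed_graph_lift1 closed_graph_lift2)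
  have D: "(C\<^sub>1 \<inter> C\<^sub>2) \<times> UNIV = C\<^sub>1 \<times> (UNIV :: ('b \<times> 'b) set) \<inter> C\<^sub>2 \<times> UNIV" by blast
  obtain l v\<^sub>1 v\<^sub>2 where l: "l \<ge> 0"
    and v: "v\<^sub>1 \<in> limiting_normal_cone_wrt (C\<^sub>1 \<times> UNIV) (x, y\<^sub>1, y\<^sub>2) (graph_lift1 F\<^sub>1)"
      "v\<^sub>2 \<in> limiting_normal_cone_wrt (C\<^sub>2 \<times> UNIV) (x, y\<^sub>1, y\<^sub>2) (graph_lift2 F\<^sub>2)"
    and sum: "v\<^sub>1 + v\<^sub>2 = l *\<^sub>R (xs, - ys, - ys)" and nz: "l = 0 \<Longrightarrow> v\<^sub>1 \<noteq> 0 \<or> v\<^sub>2 \<noteq> 0"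
    by (rule limiting_normal_cone_wrt_intersection
        [OF cl q2[unfolded normal_densed_qualification_def] xs[unfolded D]]) blast
  \<comment> \<open>\<open>c\<close> and \<open>c'\<close> name the components in the free
    coordinates of the two lifts.\<close>
  obtain a b c a' b' c' where v_eq: "v\<^sub>1 = (a, b, c)" "v\<^sub>2 = (a', c', b')" by (metis prod_cases3)
  have zero: "c = 0" "c' = 0" and cod: "a \<in> coderivative_wrt C\<^sub>1 F\<^sub>1 x y\<^sub>1 (- b)"
    "a' \<in> coderivative_wrt C\<^sub>2 F\<^sub>2 x y\<^sub>2 (- b')"
    using limiting_normal_cone_wrt_graph_lift1[OF v(1)[unfolded v_eq]]
      limiting_normal_cone_wrt_graph_lift2[OF v(2)[unfolded v_eq]] by simp_all
  \<comment> \<open>As \<open>c\<close> and \<open>c'\<close> vanish, \<open>b\<close> and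
    \<open>b'\<close> alone make up the second and third components of the sum.\<close>
  have comp: "a + a' = l *\<^sub>R xs" "- b = l *\<^sub>R ys" "- b' = l *\<^sub>R ys"
    using sum by (simp_all add: v_eq zero)
  have "l \<noteq> 0"
  proof
    assume "l = 0"
    \<comment> \<open>With \<open>l = 0\<close>, \<open>a\<close> lies in both sets of the
      qualification condition, so both normals vanish, against \<open>nz\<close>.\<close>
    with comp have b: "b = 0" "b' = 0" and a': "a = - a'" by (simp_all add: eq_neg_iff_add_eq_0)
    then have "a \<in> coderivative_wrt C\<^sub>1 F\<^sub>1 x y\<^sub>1 0 \<inter> uminus ` coderivative_wrt C\<^sub>2 F\<^sub>2 x y\<^sub>2 0"
      using cod by auto
    then have "a = 0" using q1 unfolding coderivative_qualification_def by simp
    with a' b nz[OF \<open>l = 0\<close>] show False by (simp add: v_eq zero zero_prod_def)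
  qed
  with l have l: "inverse l \<ge> 0" "l \<noteq> 0" by auto
  have "inverse l *\<^sub>R a \<in> coderivative_wrt C\<^sub>1 F\<^sub>1 x y\<^sub>1 ys"
    "inverse l *\<^sub>R a' \<in> coderivative_wrt C\<^sub>2 F\<^sub>2 x y\<^sub>2 ys"
    using cod[THEN coderivative_wrt_scaleR, OF l(1)] l(2) by (simp_all add: comp)
  moreover have "xs = inverse l *\<^sub>R a + inverse l *\<^sub>R a'"
    using l(2) by (simp add: comp(1) flip: scaleR_add_right)
  ultimately show ?thesis by (metis set_plus_intro)
qed

text \<open>Common core of both assertions, which differ only in how convergent splittings
  \<open>v\<close> are obtained.\<close>

lemma coderivative_msum_subsequence:
  fixes F\<^sub>1 F\<^sub>2 :: "('a::euclidean_space, 'b::euclidean_space) multifun"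
  assumes C: "closed C\<^sub>1" "closed C\<^sub>2"
    and q1: "coderivative_qualification C\<^sub>1 C\<^sub>2 F\<^sub>1 F\<^sub>2 x y\<^sub>1 y\<^sub>2"
    and q2: "normal_densed_qualification C\<^sub>1 C\<^sub>2 F\<^sub>1 F\<^sub>2 x y\<^sub>1 y\<^sub>2"
    and lc: "locally_closed_around (gph F\<^sub>1) (x, y\<^sub>1)" "locally_closed_around (gph F\<^sub>2) (x, y\<^sub>2)"
    and u: "tends_in u ((C\<^sub>1 \<inter> C\<^sub>2) \<times> UNIV) (x, y)"
    and us: "\<And>k. us k \<in> frechet_normal_cone_wrt ((C\<^sub>1 \<inter> C\<^sub>2) \<times> UNIV) (u k)
      (gph (mrestrict (msum F\<^sub>1 F\<^sub>2) (C\<^sub>1 \<inter> C\<^sub>2)))" "us \<longlonglongrightarrow> (xs, - ys)"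
    and v: "\<And>k. v k \<in> sum_splitting F\<^sub>1 F\<^sub>2 (u k)"
    and r: "strict_mono (r :: nat \<Rightarrow> nat)" "(v \<circ> r) \<longlonglongrightarrow> (y\<^sub>1, y\<^sub>2)"
  shows "xs \<in> coderivative_wrt C\<^sub>1 F\<^sub>1 x y\<^sub>1 ys + coderivative_wrt C\<^sub>2 F\<^sub>2 x y\<^sub>2 ys"
proof (rule coderivative_msum_decomposition[OF C q1 q2 lc])
  define w where "w k = (fst (u (r k)), v (r k))" for k
  define ws where "ws k = (fst (us (r k)), snd (us (r k)), snd (us (r k)))" for k
  have lim: "(\<lambda>k. u (r k)) \<longlonglongrightarrow> (x, y)" "(\<lambda>k. us (r k)) \<longlonglongrightarrow> (xs, - ys)" "(\<lambda>k. v (r k)) \<longlonglongrightarrow> (y\<^sub>1, y\<^sub>2)"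
    using u LIMSEQ_subseq_LIMSEQ[OF _ r(1)] us(2) r(2) by (auto simp: tends_in_def o_def)
  have "w \<longlonglongrightarrow> (x, y\<^sub>1, y\<^sub>2)"
    using tendsto_Pair[OF tendsto_fst[OF lim(1)] lim(3)] by (simp add: w_def[abs_def])
  moreover have "w k \<in> (graph_lift1 F\<^sub>1 \<inter> graph_lift2 F\<^sub>2) \<inter> (C\<^sub>1 \<inter> C\<^sub>2) \<times> UNIV" for k
    using u v[of "r k"]
    by (cases "u (r k)") (auto simp: w_def tends_in_def sum_splitting_def graph_lift1_def
        graph_lift2_def gph_def dest!: spec[of _ "r k"])
  moreover have "ws \<longlonglongrightarrow> (xs, - ys, - ys)"
    using tendsto_Pair[OF tendsto_fst[OF lim(2)] tendsto_Pair[OF tendsto_snd tendsto_snd, OF lim(2,2)]]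
    by (simp add: ws_def[abs_def])
  moreover have "ws k \<in> frechet_normal_cone_wrt ((C\<^sub>1 \<inter> C\<^sub>2) \<times> UNIV) (w k)
      (graph_lift1 F\<^sub>1 \<inter> graph_lift2 F\<^sub>2)" for k
  proof -
    have "snd (u (r k)) = fst (v (r k)) + snd (v (r k))"
      using v[of "r k"] by (auto simp: sum_splitting_def split: prod.splits)
    then have "(fst (u (r k)), fst (v (r k)) + snd (v (r k))) = u (r k)"
      by (metis prod.collapse)
    then show ?thesis
      using frechet_normal_cone_wrt_sum_splitting[of "fst (us (r k))" "- snd (us (r k))"
          "C\<^sub>1 \<inter> C\<^sub>2" "fst (u (r k))" "fst (v (r k))" "snd (v (r k))" F\<^sub>1 F\<^sub>2] us(1)[of "r k"]
      by (simp add: w_def ws_def)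
  qed
  ultimately show "(xs, - ys, - ys) \<in> limiting_normal_cone_wrt ((C\<^sub>1 \<inter> C\<^sub>2) \<times> UNIV) (x, y\<^sub>1, y\<^sub>2)
      (graph_lift1 F\<^sub>1 \<inter> graph_lift2 F\<^sub>2)"
    unfolding limiting_normal_cone_wrt_def tends_in_def by blast
qed

text \<open>Inner semicontinuity tests only sequences in the domain of the splitting map; points of
  the graph of the sum lie there.\<close>

lemma coderivative_msum_sequences:
  assumes "xs \<in> coderivative_wrt C (msum F\<^sub>1 F\<^sub>2) x y ys"
  obtains u us where "tends_in u (mdom (sum_splitting F\<^sub>1 F\<^sub>2) \<inter> C \<times> UNIV) (x, y)"
    "\<And>k. us k \<in> frechet_normal_cone_wrt (C \<times> UNIV) (u k) (gph (mrestrict (msum F\<^sub>1 F\<^sub>2) C))"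
    "us \<longlonglongrightarrow> (xs, - ys)"
proof -
  obtain u us where u: "tends_in u (gph (mrestrict (msum F\<^sub>1 F\<^sub>2) C) \<inter> C \<times> UNIV) (x, y)"
    "\<And>k. us k \<in> frechet_normal_cone_wrt (C \<times> UNIV) (u k) (gph (mrestrict (msum F\<^sub>1 F\<^sub>2) C))"
    "us \<longlonglongrightarrow> (xs, - ys)"
    using assms unfolding coderivative_wrt_def limiting_normal_cone_wrt_def by blast
  have "gph (mrestrict (msum F\<^sub>1 F\<^sub>2) C) \<inter> C \<times> UNIV \<subseteq> mdom (sum_splitting F\<^sub>1 F\<^sub>2) \<inter> C \<times> UNIV"
    by (auto simp: gph_def mrestrict_def msum_def mdom_def sum_splitting_def elim!: set_plus_elim) blast
  with u(1) have "tends_in u (mdom (sum_splitting F\<^sub>1 F\<^sub>2) \<inter> C \<times> UNIV) (x, y)"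
    unfolding tends_in_def by blast
  with u(2,3) show thesis by (rule that[rotated 1])
qed

theorem theorem11:
  fixes F\<^sub>1 F\<^sub>2 :: "real ^ 'n \<Rightarrow> (real ^ 'm) set"
    and C\<^sub>1 C\<^sub>2 :: "(real ^ 'n) set"
    and x :: "real ^ 'n" and y :: "real ^ 'm"
  assumes "(x, y) \<in> gph (msum F\<^sub>1 F\<^sub>2)"
    and "C\<^sub>1 \<noteq> {}" "closed C\<^sub>1" "convex C\<^sub>1"
    and "C\<^sub>2 \<noteq> {}" "closed C\<^sub>2" "convex C\<^sub>2"
    and "x \<in> C\<^sub>1 \<inter> C\<^sub>2"
  shows
    "(\<forall>y\<^sub>1 y\<^sub>2.
        (y\<^sub>1, y\<^sub>2) \<in> sum_splitting F\<^sub>1 F\<^sub>2 (x, y) \<and>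
        coderivative_qualification C\<^sub>1 C\<^sub>2 F\<^sub>1 F\<^sub>2 x y\<^sub>1 y\<^sub>2 \<and>
        normal_densed_qualification C\<^sub>1 C\<^sub>2 F\<^sub>1 F\<^sub>2 x y\<^sub>1 y\<^sub>2 \<and>
        locally_closed_around (gph F\<^sub>1) (x, y\<^sub>1) \<and>
        locally_closed_around (gph F\<^sub>2) (x, y\<^sub>2) \<and>
        inner_semicontinuous (sum_splitting F\<^sub>1 F\<^sub>2) ((C\<^sub>1 \<inter> C\<^sub>2) \<times> UNIV) (x, y) (y\<^sub>1, y\<^sub>2) \<longrightarrow>
        (\<forall>ys. coderivative_wrt (C\<^sub>1 \<inter> C\<^sub>2) (msum F\<^sub>1 F\<^sub>2) x y ys
              \<subseteq> coderivative_wrt C\<^sub>1 F\<^sub>1 x y\<^sub>1 ys + coderivative_wrt C\<^sub>2 F\<^sub>2 x y\<^sub>2 ys))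
     \<and>
     ((\<forall>(y\<^sub>1, y\<^sub>2) \<in> sum_splitting F\<^sub>1 F\<^sub>2 (x, y).
        coderivative_qualification C\<^sub>1 C\<^sub>2 F\<^sub>1 F\<^sub>2 x y\<^sub>1 y\<^sub>2 \<and>
        normal_densed_qualification C\<^sub>1 C\<^sub>2 F\<^sub>1 F\<^sub>2 x y\<^sub>1 y\<^sub>2 \<and>
        locally_closed_around (gph F\<^sub>1) (x, y\<^sub>1) \<and>
        locally_closed_around (gph F\<^sub>2) (x, y\<^sub>2)) \<and>
      (\<exists>\<delta>>0. \<forall>x' \<in> C\<^sub>1 \<inter> C\<^sub>2. dist x' x < \<delta> \<longrightarrow>
        closed_graph_at F\<^sub>1 (C\<^sub>1 \<inter> C\<^sub>2) x' \<and> closed_graph_at F\<^sub>2 (C\<^sub>1 \<inter> C\<^sub>2) x') \<and>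
      inner_semicompact (sum_splitting F\<^sub>1 F\<^sub>2) ((C\<^sub>1 \<inter> C\<^sub>2) \<times> UNIV) (x, y) \<longrightarrow>
      (\<forall>ys. coderivative_wrt (C\<^sub>1 \<inter> C\<^sub>2) (msum F\<^sub>1 F\<^sub>2) x y ys
            \<subseteq> (\<Union>(y\<^sub>1, y\<^sub>2) \<in> sum_splitting F\<^sub>1 F\<^sub>2 (x, y).
                 coderivative_wrt C\<^sub>1 F\<^sub>1 x y\<^sub>1 ys + coderivative_wrt C\<^sub>2 F\<^sub>2 x y\<^sub>2 ys)))"
proof (intro conjI allI impI subsetI)
  note C = \<open>closed C\<^sub>1\<close> \<open>closed C\<^sub>2\<close>
  fix y\<^sub>1 y\<^sub>2 ys xs
  assume A: "(y\<^sub>1, y\<^sub>2) \<in> sum_splitting F\<^sub>1 F\<^sub>2 (x, y) \<and>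
      coderivative_qualification C\<^sub>1 C\<^sub>2 F\<^sub>1 F\<^sub>2 x y\<^sub>1 y\<^sub>2 \<and>
      normal_densed_qualification C\<^sub>1 C\<^sub>2 F\<^sub>1 F\<^sub>2 x y\<^sub>1 y\<^sub>2 \<and>
      locally_closed_around (gph F\<^sub>1) (x, y\<^sub>1) \<and>
      locally_closed_around (gph F\<^sub>2) (x, y\<^sub>2) \<and>
      inner_semicontinuous (sum_splitting F\<^sub>1 F\<^sub>2) ((C\<^sub>1 \<inter> C\<^sub>2) \<times> UNIV) (x, y) (y\<^sub>1, y\<^sub>2)"
    and xs: "xs \<in> coderivative_wrt (C\<^sub>1 \<inter> C\<^sub>2) (msum F\<^sub>1 F\<^sub>2) x y ys"
  obtain u us where u: "tends_in u (mdom (sum_splitting F\<^sub>1 F\<^sub>2) \<inter> (C\<^sub>1 \<inter> C\<^sub>2) \<times> UNIV) (x, y)"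
    and us: "\<And>k. us k \<in> frechet_normal_cone_wrt ((C\<^sub>1 \<inter> C\<^sub>2) \<times> UNIV) (u k)
      (gph (mrestrict (msum F\<^sub>1 F\<^sub>2) (C\<^sub>1 \<inter> C\<^sub>2)))" "us \<longlonglongrightarrow> (xs, - ys)"
    using coderivative_msum_sequences[OF xs] by blast
  obtain v where v: "\<And>k. v k \<in> sum_splitting F\<^sub>1 F\<^sub>2 (u k)" "v \<longlonglongrightarrow> (y\<^sub>1, y\<^sub>2)"
    using A u unfolding inner_semicontinuous_def by blast
  have u': "tends_in u ((C\<^sub>1 \<inter> C\<^sub>2) \<times> UNIV) (x, y)" using u by (simp add: tends_in_def)
  show "xs \<in> coderivative_wrt C\<^sub>1 F\<^sub>1 x y\<^sub>1 ys + coderivative_wrt C\<^sub>2 F\<^sub>2 x y\<^sub>2 ys"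
    \<comment> \<open>Inner semicontinuity makes the whole sequence of splittings converge to the
      given pair.\<close>
    by (rule coderivative_msum_subsequence[where r = id, OF C _ _ _ _ u' us v(1)])
      (use A v(2) in \<open>simp_all add: strict_mono_def\<close>)
next
  note C = \<open>closed C\<^sub>1\<close> \<open>closed C\<^sub>2\<close>
  fix ys xs
  assume A: "(\<forall>(y\<^sub>1, y\<^sub>2) \<in> sum_splitting F\<^sub>1 F\<^sub>2 (x, y).
        coderivative_qualification C\<^sub>1 C\<^sub>2 F\<^sub>1 F\<^sub>2 x y\<^sub>1 y\<^sub>2 \<and>
        normal_densed_qualification C\<^sub>1 C\<^sub>2 F\<^sub>1 F\<^sub>2 x y\<^sub>1 y\<^sub>2 \<and>
        locally_closed_around (gph F\<^sub>1) (x, y\<^sub>1) \<and>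
        locally_closed_around (gph F\<^sub>2) (x, y\<^sub>2)) \<and>
      (\<exists>\<delta>>0. \<forall>x' \<in> C\<^sub>1 \<inter> C\<^sub>2. dist x' x < \<delta> \<longrightarrow>
        closed_graph_at F\<^sub>1 (C\<^sub>1 \<inter> C\<^sub>2) x' \<and> closed_graph_at F\<^sub>2 (C\<^sub>1 \<inter> C\<^sub>2) x') \<and>
      inner_semicompact (sum_splitting F\<^sub>1 F\<^sub>2) ((C\<^sub>1 \<inter> C\<^sub>2) \<times> UNIV) (x, y)"
    and xs: "xs \<in> coderivative_wrt (C\<^sub>1 \<inter> C\<^sub>2) (msum F\<^sub>1 F\<^sub>2) x y ys"
  note q = conjunct1[OF A] and cg0 = conjunct1[OF conjunct2[OF A]]
    and sc = conjunct2[OF conjunct2[OF A]]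
  obtain u us where u0: "tends_in u (mdom (sum_splitting F\<^sub>1 F\<^sub>2) \<inter> (C\<^sub>1 \<inter> C\<^sub>2) \<times> UNIV) (x, y)"
    and us: "\<And>k. us k \<in> frechet_normal_cone_wrt ((C\<^sub>1 \<inter> C\<^sub>2) \<times> UNIV) (u k)
      (gph (mrestrict (msum F\<^sub>1 F\<^sub>2) (C\<^sub>1 \<inter> C\<^sub>2)))" "us \<longlonglongrightarrow> (xs, - ys)"
    using coderivative_msum_sequences[OF xs] by blast
  have u: "tends_in u ((C\<^sub>1 \<inter> C\<^sub>2) \<times> UNIV) (x, y)" using u0 by (simp add: tends_in_def)
  obtain v r z where v: "\<And>k. v k \<in> sum_splitting F\<^sub>1 F\<^sub>2 (u k)"
    and r: "strict_mono (r :: nat \<Rightarrow> nat)" "(v \<circ> r) \<longlonglongrightarrow> z"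
    using sc[unfolded inner_semicompact_def, rule_format, OF u] by blast
  obtain y\<^sub>1 y\<^sub>2 where z: "z = (y\<^sub>1, y\<^sub>2)" by (cases z)
  have v': "fst (v k) \<in> F\<^sub>1 (fst (u k))" "snd (v k) \<in> F\<^sub>2 (fst (u k))"
    "fst (v k) + snd (v k) = snd (u k)" for k
    using v[of k] by (auto simp: sum_splitting_def split: prod.splits)
  have cg: "closed_graph_at F\<^sub>1 (C\<^sub>1 \<inter> C\<^sub>2) x" "closed_graph_at F\<^sub>2 (C\<^sub>1 \<inter> C\<^sub>2) x"
  proof -
    obtain \<delta> where "\<delta> > 0" and \<delta>: "\<forall>x' \<in> C\<^sub>1 \<inter> C\<^sub>2. dist x' x < \<delta> \<longrightarrow>
        closed_graph_at F\<^sub>1 (C\<^sub>1 \<inter> C\<^sub>2) x' \<and> closed_graph_at F\<^sub>2 (C\<^sub>1 \<inter> C\<^sub>2) x'"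
      using cg0 by blast
    then have "dist x x < \<delta>" by simp
    from mp[OF bspec[OF \<delta> \<open>x \<in> C\<^sub>1 \<inter> C\<^sub>2\<close>] this]
    show "closed_graph_at F\<^sub>1 (C\<^sub>1 \<inter> C\<^sub>2) x" "closed_graph_at F\<^sub>2 (C\<^sub>1 \<inter> C\<^sub>2) x"
      by (rule conjunct1, rule conjunct2)
  qed
  have ur: "(\<lambda>k. u (r k)) \<longlonglongrightarrow> (x, y)"
    using u LIMSEQ_subseq_LIMSEQ[OF _ r(1)] by (auto simp: tends_in_def o_def)
  have fu: "tends_in (\<lambda>k. fst (u (r k))) (C\<^sub>1 \<inter> C\<^sub>2) x"
    using u tendsto_fst[OF ur] by (auto simp: tends_in_def mem_Times_iff)
  have lim: "(\<lambda>k. fst (v (r k))) \<longlonglongrightarrow> y\<^sub>1" "(\<lambda>k. snd (v (r k))) \<longlonglongrightarrow> y\<^sub>2"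
    using tendsto_fst[OF r(2)] tendsto_snd[OF r(2)] by (simp_all add: z o_def)
  \<comment> \<open>The closed-graph property puts the limit of the splittings into the index set of
    the union, where all pointwise conditions are assumed.\<close>
  have "y\<^sub>1 \<in> F\<^sub>1 x" "y\<^sub>2 \<in> F\<^sub>2 x"
    using cg[unfolded closed_graph_at_def, THEN spec, THEN spec, THEN spec, THEN mp, OF conjI[OF fu conjI]] lim v'(1,2)
    by simp_all
  moreover have "y\<^sub>1 + y\<^sub>2 = y"
    using LIMSEQ_unique[OF tendsto_add[OF lim] ] tendsto_snd[OF ur] by (simp add: v')
  ultimately have S: "(y\<^sub>1, y\<^sub>2) \<in> sum_splitting F\<^sub>1 F\<^sub>2 (x, y)" by (simp add: sum_splitting_def)
  note q' = bspec[OF q S, unfolded prod.case]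
  have "xs \<in> coderivative_wrt C\<^sub>1 F\<^sub>1 x y\<^sub>1 ys + coderivative_wrt C\<^sub>2 F\<^sub>2 x y\<^sub>2 ys"
    by (rule coderivative_msum_subsequence[OF C q'[THEN conjunct1] q'[THEN conjunct2, THEN conjunct1]
          q'[THEN conjunct2, THEN conjunct2, THEN conjunct1]
          q'[THEN conjunct2, THEN conjunct2, THEN conjunct2] u us v r[unfolded z]])
  then show "xs \<in> (\<Union>(y\<^sub>1, y\<^sub>2) \<in> sum_splitting F\<^sub>1 F\<^sub>2 (x, y).
      coderivative_wrt C\<^sub>1 F\<^sub>1 x y\<^sub>1 ys + coderivative_wrt C\<^sub>2 F\<^sub>2 x y\<^sub>2 ys)"
    by (subst UN_iff) (rule bexI[OF _ S], simp only: prod.case)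
qed

end
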